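(* Let $0 \neq \psi\in (\mathfrak{n}^+/[\mathfrak{n}^+, \mathfrak{n}^+])^*$, and suppose $V$ is a simple object in $\mathcal{W}(\psi)$. Then $V \cong L(\psi, \xi)$ for some $\xi \in \mathbb{C}$.
   Context: $\mathfrak{g}$ is the Virasoro Lie algebra over $\mathbb{C}$, with basis $\{z, d_k \mid k \in \mathbb{Z}\}$ and bracket $[d_k,d_j]=(k-j)d_{k+j}+\delta_{j,-k}\frac{k^3-k}{12}z$, $[z,d_k]=0$; $\mathfrak{n}^+=\mathrm{span}_{\mathbb{C}}\{d_k \mid k>0\}$. Elements $\psi\in(\mathfrak{n}^+/[\mathfrak{n}^+,\mathfrak{n}^+])^*$ are identified with Lie algebra homomorphisms $\mathfrak{n}^+\to\mathbb{C}$. $\mathcal{W}$ is the full subcategory of $\mathfrak{g}$-modules on which $\mathfrak{n}^+$ acts locally finitely. $\mathcal{W}(\psi)$ is the full subcategory of those $V\in\mathcal{W}$ with $V=V^\psi$, where $V^\psi=\{v\in V \mid (x-\psi(x))^k v=0 \text{ for all } x\in\mathfrak{n}^+ \text{ and } k\gg 0\}$. For $\xi\in\mathbb{C}$, $L(\psi,\xi)=U(\mathfrak{g})\otimes_{U(\mathfrak{n}^+\oplus\mathbb{C}z)}\mathbb{C}_{\psi,\xi}$, where $\mathbb{C}_{\psi,\xi}$ is the one-dimensional $\mathfrak{n}^+\oplus\mathbb{C}z$-module on which $\mathfrak{n}^+$ acts by $\psi$ and $z$ acts by $\xi$. *)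

theory Defs
  imports Complex_Main "HOL-Library.Poly_Mapping" "HOL-Computational_Algebra.Group_Closure"
begin

section \<open>Complex vector spaces, associative algebras and Lie algebras\<close>

class complex_vector = ab_group_add +
  fixes scaleC :: "complex \<Rightarrow> 'a \<Rightarrow> 'a"  (infixr \<open>*\<^sub>C\<close> 75)
  assumes scaleC_add_right: "a *\<^sub>C (x + y) = a *\<^sub>C x + a *\<^sub>C y"
    and scaleC_add_left: "(a + b) *\<^sub>C x = a *\<^sub>C x + b *\<^sub>C x"
    and scaleC_scaleC: "a *\<^sub>C (b *\<^sub>C x) = (a * b) *\<^sub>C x"
    and scaleC_one: "1 *\<^sub>C x = x"

global_interpretation complex_vec: vector_space "scaleC :: complex \<Rightarrow> 'a \<Rightarrow> 'a::complex_vector"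
  by unfold_locales (simp_all add: scaleC_add_right scaleC_add_left scaleC_scaleC scaleC_one)

class complex_algebra_1 = complex_vector + ring_1 +
  assumes mult_scaleC_left: "(a *\<^sub>C x) * y = a *\<^sub>C (x * y)"
    and mult_scaleC_right: "x * (a *\<^sub>C y) = a *\<^sub>C (x * y)"

class complex_lie_algebra = complex_vector +
  fixes lie_bracket :: "'a \<Rightarrow> 'a \<Rightarrow> 'a"
  assumes lie_add_left: "lie_bracket (x + y) w = lie_bracket x w + lie_bracket y w"
    and lie_scaleC_left: "lie_bracket (a *\<^sub>C x) w = a *\<^sub>C lie_bracket x w"
    and lie_self: "lie_bracket x x = 0"
    and lie_add_right: "lie_bracket w (x + y) = lie_bracket w x + lie_bracket w y"
    and lie_scaleC_right: "lie_bracket w (a *\<^sub>C x) = a *\<^sub>C lie_bracket w x"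
    and lie_jacobi: "lie_bracket x (lie_bracket y w) + lie_bracket y (lie_bracket w x)
                       + lie_bracket w (lie_bracket x y) = 0"

instantiation complex :: complex_algebra_1
begin

definition scaleC_complex :: "complex \<Rightarrow> complex \<Rightarrow> complex" where
  "scaleC_complex = (*)"

instance by standard (simp_all add: scaleC_complex_def algebra_simps)

end

definition linC :: "('a::complex_vector \<Rightarrow> 'b::complex_vector) \<Rightarrow> bool" where
  "linC f \<longleftrightarrow> (\<forall>x y. f (x + y) = f x + f y) \<and> (\<forall>c x. f (c *\<^sub>C x) = c *\<^sub>C f x)"

lemma linC_add: "linC f \<Longrightarrow> f (x + y) = f x + f y"
  and linC_scaleC: "linC f \<Longrightarrow> f (c *\<^sub>C x) = c *\<^sub>C f x"
  by (simp_all add: linC_def)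

definition lie_hom_assoc :: "('l::complex_lie_algebra \<Rightarrow> 'a::complex_algebra_1) \<Rightarrow> bool" where
  "lie_hom_assoc f \<longleftrightarrow> linC f \<and> (\<forall>x y. f (lie_bracket x y) = f x * f y - f y * f x)"

subsection \<open>Linear extension from a basis\<close>

definition lin_ext :: "('k \<Rightarrow> 'a::complex_vector) \<Rightarrow> ('k \<Rightarrow>\<^sub>0 complex) \<Rightarrow> 'a" where
  "lin_ext f p = (\<Sum>k\<in>Poly_Mapping.keys p. Poly_Mapping.lookup p k *\<^sub>C f k)"

lemma lin_ext_superset:
  assumes "finite K" "Poly_Mapping.keys p \<subseteq> K"
  shows "lin_ext f p = (\<Sum>k\<in>K. Poly_Mapping.lookup p k *\<^sub>C f k)"
  unfolding lin_ext_def
  by (rule sum.mono_neutral_left) (use assms in \<open>auto simp: in_keys_iff\<close>)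

lemma lin_ext_add: "lin_ext f (p + q) = lin_ext f p + lin_ext f q"
proof -
  let ?K = "Poly_Mapping.keys p \<union> Poly_Mapping.keys q"
  have "lin_ext f r = (\<Sum>k\<in>?K. Poly_Mapping.lookup r k *\<^sub>C f k)" if "r = p \<or> r = q \<or> r = p + q" for r
    by (rule lin_ext_superset) (use that Poly_Mapping.keys_add[of p q] in auto)
  then show ?thesis
    by (simp add: Poly_Mapping.lookup_add scaleC_add_left sum.distrib)
qed

lemma lin_ext_zero [simp]: "lin_ext f 0 = 0"
  by (simp add: lin_ext_def)

lemma lin_ext_single [simp]: "lin_ext f (Poly_Mapping.single k c) = c *\<^sub>C f k"
  by (subst lin_ext_superset[of "{k}"]) auto

lemma lookup_map_mult [simp]: "Poly_Mapping.lookup (Poly_Mapping.map ((*) c) p) k = (c::complex) * Poly_Mapping.lookup p k"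
  by (simp add: Poly_Mapping.map.rep_eq when_def)

lemma lin_ext_map_mult: "lin_ext f (Poly_Mapping.map ((*) c) p) = c *\<^sub>C lin_ext f p"
  by (subst lin_ext_superset[of "Poly_Mapping.keys p"])
    (auto simp: in_keys_iff lin_ext_def complex_vec.scale_sum_right scaleC_scaleC)

lemma lin_ext_uminus: "lin_ext f (- p) = - lin_ext f p"
  using lin_ext_add[of f p "- p"] by (simp add: add_eq_0_iff)

lemma lin_ext_diff: "lin_ext f (p - q) = lin_ext f p - lin_ext f q"
  using lin_ext_add[of f p "- q"] by (simp add: lin_ext_uminus)

lemma poly_mapping_add_induct [case_names zero single add]:
  assumes "P 0" "\<And>k c. P (Poly_Mapping.single k c)" "\<And>p q. P p \<Longrightarrow> P q \<Longrightarrow> P (p + q)"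
  shows "P (p :: 'k \<Rightarrow>\<^sub>0 'b::ab_group_add)"
proof (induction p rule: Poly_Mapping.update_induct)
  case const
  then show ?case by (rule assms(1))
next
  case (update p k c)
  have "Poly_Mapping.update k c p = p + Poly_Mapping.single k c"
    using update by (intro poly_mapping_eqI)
      (auto simp: Poly_Mapping.lookup_update lookup_add lookup_single when_def in_keys_iff)
  then show ?case using update assms by metis
qed

section \<open>The universal enveloping algebra\<close>

text \<open>The free monoid is written additively, so that finitely supported functions
  from it to the complex numbers carry the convolution product: they form the free associative unital
  algebra on the set of all elements of the type.\<close>

datatype 'a free_monoid = Word (letters: "'a list")

instantiation free_monoid :: (type) monoid_add
begin

definition zero_free_monoid :: "'a free_monoid" where
  "0 = Word []"

definition plus_free_monoid :: "'a free_monoid \<Rightarrow> 'a free_monoid \<Rightarrow> 'a free_monoid" where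
  "u + v = Word (letters u @ letters v)"

instance by standard (simp_all add: zero_free_monoid_def plus_free_monoid_def)

end

type_synonym 'a free_alg = "'a free_monoid \<Rightarrow>\<^sub>0 complex"

definition free_gen :: "'a \<Rightarrow> 'a free_alg" where
  "free_gen x = Poly_Mapping.single (Word [x]) 1"

definition free_const :: "complex \<Rightarrow> 'a free_alg" where
  "free_const c = Poly_Mapping.single 0 c"

definition uea_relators :: "'l::complex_lie_algebra free_alg set" where
  "uea_relators =
     {free_gen (x + y) - free_gen x - free_gen y | x y. True}
   \<union> {free_gen (c *\<^sub>C x) - free_const c * free_gen x | c x. True}
   \<union> {free_gen x * free_gen y - free_gen y * free_gen x - free_gen (lie_bracket x y) | x y. True}"

definition uea_ideal :: "'l::complex_lie_algebra free_alg set" where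
  "uea_ideal = group_closure {p * r * q | p r q. r \<in> uea_relators}"

lemma uea_ideal_uminus: "a \<in> uea_ideal \<Longrightarrow> - a \<in> uea_ideal"
  and uea_ideal_add: "a \<in> uea_ideal \<Longrightarrow> b \<in> uea_ideal \<Longrightarrow> a + b \<in> uea_ideal"
  and uea_ideal_diff: "a \<in> uea_ideal \<Longrightarrow> b \<in> uea_ideal \<Longrightarrow> a - b \<in> uea_ideal"
  by (simp_all add: uea_ideal_def group_closure_add group_closure.diff)

lemma uea_ideal_mult: "a \<in> uea_ideal \<Longrightarrow> s * a * t \<in> uea_ideal"
  unfolding uea_ideal_def
proof (induction a rule: group_closure.induct)
  case (base a)
  show ?case
  proof (cases "a = 0")
    case False
    then obtain p r q where "a = p * r * q" "r \<in> uea_relators" using base by auto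
    then have "s * a * t = (s * p) * r * (q * t)" by (simp add: mult.assoc)
    then show ?thesis using \<open>r \<in> uea_relators\<close> by (intro group_closure.base) blast
  qed simp
next
  case (diff a b)
  then show ?case by (simp add: algebra_simps group_closure.diff)
qed

lemma uea_ideal_mult_left: "a \<in> uea_ideal \<Longrightarrow> s * a \<in> uea_ideal"
  and uea_ideal_mult_right: "a \<in> uea_ideal \<Longrightarrow> a * t \<in> uea_ideal"
  using uea_ideal_mult[of a s 1] uea_ideal_mult[of a 1 t] by simp_all

lemma uea_relators_in_ideal: "r \<in> uea_relators \<Longrightarrow> r \<in> uea_ideal"
  unfolding uea_ideal_def by (rule group_closure.base, rule insertI2, rule CollectI)
    (metis mult_1 mult_1_right)

definition free_eval :: "('l \<Rightarrow> 'a::complex_algebra_1) \<Rightarrow> 'l free_alg \<Rightarrow> 'a" where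
  "free_eval f = lin_ext (\<lambda>w. prod_list (map f (letters w)))"

lemma free_eval_zero [simp]: "free_eval f 0 = 0"
  and free_eval_add: "free_eval f (p + q) = free_eval f p + free_eval f q"
  and free_eval_diff: "free_eval f (p - q) = free_eval f p - free_eval f q"
  by (simp_all add: free_eval_def lin_ext_add lin_ext_diff)

lemma free_eval_gen [simp]: "free_eval f (free_gen x) = f x"
  by (simp add: free_eval_def free_gen_def scaleC_one)

lemma free_eval_const [simp]: "free_eval f (free_const c) = c *\<^sub>C 1"
  by (simp add: free_eval_def free_const_def zero_free_monoid_def)

lemma free_eval_one [simp]: "free_eval f 1 = 1"
  using free_eval_const[of f 1] by (simp add: free_const_def scaleC_one)

lemma free_eval_mult: "free_eval f (p * q) = free_eval f p * free_eval f q"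
proof (induction p rule: poly_mapping_add_induct)
  case (single k c)
  show ?case
  proof (induction q rule: poly_mapping_add_induct)
    case (single l d)
    show ?case
      by (simp add: free_eval_def mult_single plus_free_monoid_def mult_scaleC_left
          mult_scaleC_right scaleC_scaleC)
  qed (simp_all add: free_eval_add distrib_left)
qed (simp_all add: free_eval_add distrib_right)

lemma free_eval_ideal:
  assumes "lie_hom_assoc f" "a \<in> uea_ideal"
  shows "free_eval f a = 0"
proof -
  have f: "linC f" "f (lie_bracket x y) = f x * f y - f y * f x" for x y
    using assms(1) by (auto simp: lie_hom_assoc_def)
  have "free_eval f r = 0" if "r \<in> uea_relators" for r
    using that unfolding uea_relators_def
    by (auto simp: free_eval_diff free_eval_mult f linC_add linC_scaleC mult_scaleC_left)
  note * = this
  from assms(2) show ?thesis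
    unfolding uea_ideal_def
    by (induction rule: group_closure.induct) (auto simp: * free_eval_mult free_eval_diff)
qed

lemma lie_hom_assoc_zero: "lie_hom_assoc (\<lambda>_. 0 :: 'a::complex_algebra_1)"
  by (simp add: lie_hom_assoc_def linC_def)

quotient_type (overloaded) 'l uea = "'l::complex_lie_algebra free_alg" / "\<lambda>p q. p - q \<in> uea_ideal"
proof (rule equivpI)
  show "reflp (\<lambda>p q :: 'l free_alg. p - q \<in> uea_ideal)"
    by (simp add: reflp_def uea_ideal_def)
  show "symp (\<lambda>p q :: 'l free_alg. p - q \<in> uea_ideal)"
    unfolding symp_def by (metis minus_diff_eq uea_ideal_uminus)
  show "transp (\<lambda>p q :: 'l free_alg. p - q \<in> uea_ideal)"
  proof (rule transpI)
    fix a b c :: "'l free_alg"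
    assume "a - b \<in> uea_ideal" "b - c \<in> uea_ideal"
    then have "(a - b) + (b - c) \<in> uea_ideal" by (rule uea_ideal_add)
    then show "a - c \<in> uea_ideal" by simp
  qed
qed

instantiation uea :: (complex_lie_algebra) complex_algebra_1
begin

lift_definition zero_uea :: "'a uea" is 0 .
lift_definition one_uea :: "'a uea" is 1 .
lift_definition plus_uea :: "'a uea \<Rightarrow> 'a uea \<Rightarrow> 'a uea" is "(+)"
  by (metis add_diff_add uea_ideal_add)
lift_definition uminus_uea :: "'a uea \<Rightarrow> 'a uea" is uminus
  by (metis minus_diff_minus uea_ideal_uminus)
lift_definition minus_uea :: "'a uea \<Rightarrow> 'a uea \<Rightarrow> 'a uea" is "(-)"
proof -
  fix a b c d :: "'a free_alg"
  assume "a - b \<in> uea_ideal" "c - d \<in> uea_ideal"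
  then have "(a - b) - (c - d) \<in> uea_ideal" by (rule uea_ideal_diff)
  then show "a - c - (b - d) \<in> uea_ideal" by (simp add: algebra_simps)
qed
lift_definition times_uea :: "'a uea \<Rightarrow> 'a uea \<Rightarrow> 'a uea" is "(*)"
proof -
  fix a b c d :: "'a free_alg"
  assume "a - b \<in> uea_ideal" "c - d \<in> uea_ideal"
  then have "(a - b) * c + b * (c - d) \<in> uea_ideal"
    by (intro uea_ideal_add uea_ideal_mult_left uea_ideal_mult_right)
  then show "a * c - b * d \<in> uea_ideal" by (simp add: algebra_simps)
qed
lift_definition scaleC_uea :: "complex \<Rightarrow> 'a uea \<Rightarrow> 'a uea" is "\<lambda>c p. free_const c * p"
  by (metis right_diff_distrib uea_ideal_mult_left)

lemma free_const_commute: "p * free_const c = free_const c * (p :: 'b free_alg)"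
  by (induction p rule: poly_mapping_add_induct)
    (simp_all add: free_const_def mult_single mult.commute distrib_left distrib_right)

lemma uea_rel_eqI: "p = q \<Longrightarrow> p - q \<in> (uea_ideal :: 'a free_alg set)"
  by (simp add: uea_ideal_def)

instance
proof
  fix a b c :: "'a uea" and x y :: complex
  show "a + b + c = a + (b + c)" by transfer (rule uea_rel_eqI, simp)
  show "a + b = b + a" by transfer (rule uea_rel_eqI, simp)
  show "0 + a = a" by transfer (rule uea_rel_eqI, simp)
  show "- a + a = 0" by transfer (rule uea_rel_eqI, simp)
  show "a - b = a + - b" by transfer (rule uea_rel_eqI, simp)
  show "a * b * c = a * (b * c)" by transfer (rule uea_rel_eqI, simp add: mult.assoc)
  show "1 * a = a" by transfer (rule uea_rel_eqI, simp)
  show "a * 1 = a" by transfer (rule uea_rel_eqI, simp)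
  show "(a + b) * c = a * c + b * c" by transfer (rule uea_rel_eqI, simp add: algebra_simps)
  show "a * (b + c) = a * b + a * c" by transfer (rule uea_rel_eqI, simp add: algebra_simps)
  show "x *\<^sub>C (a + b) = x *\<^sub>C a + x *\<^sub>C b"
    by transfer (rule uea_rel_eqI, simp add: algebra_simps)
  show "(x + y) *\<^sub>C a = x *\<^sub>C a + y *\<^sub>C a"
    by transfer (rule uea_rel_eqI, simp add: free_const_def single_add algebra_simps)
  show "x *\<^sub>C (y *\<^sub>C a) = (x * y) *\<^sub>C a"
    by transfer (rule uea_rel_eqI, simp add: free_const_def mult_single mult.assoc[symmetric])
  show "1 *\<^sub>C a = a"
    by transfer (rule uea_rel_eqI, simp add: free_const_def)
  show "(x *\<^sub>C a) * b = x *\<^sub>C (a * b)"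
    by transfer (rule uea_rel_eqI, simp add: mult.assoc)
  show "a * (x *\<^sub>C b) = x *\<^sub>C (a * b)"
    by transfer (rule uea_rel_eqI, metis free_const_commute mult.assoc)
  show "(0::'a uea) \<noteq> 1"
  proof transfer
    show "(0::'a free_alg) - 1 \<notin> uea_ideal"
    proof
      assume "(0::'a free_alg) - 1 \<in> uea_ideal"
      then have "free_eval (\<lambda>_. 0 :: complex) ((0::'a free_alg) - 1) = 0"
        by (rule free_eval_ideal[OF lie_hom_assoc_zero])
      then show False by (simp only: free_eval_diff) simp
    qed
  qed
qed

end

lift_definition uea_of :: "'l::complex_lie_algebra \<Rightarrow> 'l uea" is free_gen .

lemma lie_hom_uea_of: "lie_hom_assoc uea_of"
proof -
  have "uea_of (x + y) = uea_of x + uea_of y" for x y :: 'a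
  proof transfer
    fix x y :: 'a
    have "free_gen (x + y) - free_gen x - free_gen y \<in> uea_ideal"
      by (rule uea_relators_in_ideal) (auto simp: uea_relators_def)
    then show "free_gen (x + y) - (free_gen x + free_gen y) \<in> uea_ideal"
      by (simp add: algebra_simps)
  qed
  moreover have "uea_of (c *\<^sub>C x) = c *\<^sub>C uea_of x" for c and x :: 'a
    by transfer (rule uea_relators_in_ideal, auto simp: uea_relators_def)
  moreover have "uea_of (lie_bracket x y) = uea_of x * uea_of y - uea_of y * uea_of x" for x y :: 'a
  proof transfer
    fix x y :: 'a
    have "free_gen x * free_gen y - free_gen y * free_gen x - free_gen (lie_bracket x y) \<in> uea_ideal"
      by (rule uea_relators_in_ideal) (auto simp: uea_relators_def)
    then have "- (free_gen x * free_gen y - free_gen y * free_gen x - free_gen (lie_bracket x y))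
        \<in> uea_ideal"
      by (rule uea_ideal_uminus)
    then show "free_gen (lie_bracket x y) - (free_gen x * free_gen y - free_gen y * free_gen x)
        \<in> uea_ideal"
      by simp
  qed
  ultimately show ?thesis by (simp add: lie_hom_assoc_def linC_def)
qed

text \<open>The extension of a Lie algebra homomorphism to the enveloping algebra. The value does not
  depend on the chosen representative when \<^term>\<open>f\<close> satisfies \<^const>\<open>lie_hom_assoc\<close>.\<close>

definition uea_lift :: "('l::complex_lie_algebra \<Rightarrow> 'a::complex_algebra_1) \<Rightarrow> 'l uea \<Rightarrow> 'a" where
  "uea_lift f u = free_eval f (rep_uea u)"

lemma uea_lift_abs:
  assumes "lie_hom_assoc f"
  shows "uea_lift f (abs_uea p) = free_eval f p"
proof -
  have "rep_uea (abs_uea p) - p \<in> uea_ideal"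
    by (simp add: uea.abs_eq_iff[symmetric] Quotient3_abs_rep[OF Quotient3_uea])
  from free_eval_ideal[OF assms this] show ?thesis by (simp add: uea_lift_def free_eval_diff)
qed

lemma uea_lift_simps:
  assumes "lie_hom_assoc f"
  shows "uea_lift f (uea_of x) = f x" "uea_lift f 1 = 1"
    "uea_lift f (u + v) = uea_lift f u + uea_lift f v"
    "uea_lift f (u * v) = uea_lift f u * uea_lift f v"
    "uea_lift f (c *\<^sub>C u) = c *\<^sub>C uea_lift f u"
proof -
  show "uea_lift f (uea_of x) = f x"
    by (simp add: uea_of.abs_eq uea_lift_abs[OF assms])
  show "uea_lift f 1 = 1" by (simp add: one_uea.abs_eq uea_lift_abs[OF assms])
  show "uea_lift f (u + v) = uea_lift f u + uea_lift f v"
    by (induction u rule: uea.abs_induct, induction v rule: uea.abs_induct)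
      (simp add: plus_uea.abs_eq uea_lift_abs[OF assms] free_eval_add)
  show "uea_lift f (u * v) = uea_lift f u * uea_lift f v"
    by (induction u rule: uea.abs_induct, induction v rule: uea.abs_induct)
      (simp add: times_uea.abs_eq uea_lift_abs[OF assms] free_eval_mult)
  show "uea_lift f (c *\<^sub>C u) = c *\<^sub>C uea_lift f u"
    by (induction u rule: uea.abs_induct)
      (simp add: scaleC_uea.abs_eq uea_lift_abs[OF assms] free_eval_mult mult_scaleC_left)
qed

section \<open>The Virasoro algebra\<close>

datatype vir_index = Cen | Vir int

typedef vir = "UNIV :: (vir_index \<Rightarrow>\<^sub>0 complex) set"
  morphisms vir_coords Abs_vir ..

setup_lifting type_definition_vir

instantiation vir :: complex_vector
begin

lift_definition zero_vir :: vir is 0 .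
lift_definition plus_vir :: "vir \<Rightarrow> vir \<Rightarrow> vir" is "(+)" .
lift_definition minus_vir :: "vir \<Rightarrow> vir \<Rightarrow> vir" is "(-)" .
lift_definition uminus_vir :: "vir \<Rightarrow> vir" is uminus .
lift_definition scaleC_vir :: "complex \<Rightarrow> vir \<Rightarrow> vir" is "\<lambda>c. Poly_Mapping.map ((*) c)" .

instance
  by standard (transfer; auto intro!: poly_mapping_eqI simp: algebra_simps lookup_add)+

end

lift_definition vz :: vir is "Poly_Mapping.single Cen 1" .

lift_definition vd :: "int \<Rightarrow> vir" is "\<lambda>k. Poly_Mapping.single (Vir k) 1" .

fun basis_bracket :: "vir_index \<Rightarrow> vir_index \<Rightarrow> vir" where
  "basis_bracket (Vir k) (Vir j) =
     of_int (k - j) *\<^sub>C vd (k + j) + (if j = - k then (of_int (k^3 - k) / 12) *\<^sub>C vz else 0)"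
| "basis_bracket Cen _ = 0"
| "basis_bracket _ Cen = 0"

definition vir_bracket :: "vir \<Rightarrow> vir \<Rightarrow> vir" where
  "vir_bracket x y = lin_ext (\<lambda>i. lin_ext (basis_bracket i) (vir_coords y)) (vir_coords x)"

primrec vir_basis :: "vir_index \<Rightarrow> vir" where
  "vir_basis Cen = vz"
| "vir_basis (Vir k) = vd k"

lemma vir_coords_basis: "vir_coords (vir_basis i) = Poly_Mapping.single i 1"
  by (cases i) (simp_all add: vz.rep_eq vd.rep_eq)

lemma vir_induct [case_names zero basis add]:
  assumes "P 0" "\<And>c i. P (c *\<^sub>C vir_basis i)" "\<And>x y. P x \<Longrightarrow> P y \<Longrightarrow> P (x + y)"
  shows "P x"
proof -
  have "P (Abs_vir p)" for p
  proof (induction p rule: poly_mapping_add_induct)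
    case zero
    then show ?case using assms(1) by (simp add: zero_vir_def)
  next
    case (single k c)
    have "vir_coords (Abs_vir (Poly_Mapping.single k c)) = vir_coords (c *\<^sub>C vir_basis k)"
      by (simp add: Abs_vir_inverse scaleC_vir.rep_eq vir_coords_basis)
    then show ?case using assms(2) by (metis vir_coords_inject)
  next
    case (add p q)
    then show ?case using assms(3) by (metis plus_vir.abs_eq eq_onp_same_args UNIV_I)
  qed
  then show ?thesis by (metis vir_coords_inverse)
qed

lemma vir_bracket_bilinear:
  "vir_bracket (x + y) w = vir_bracket x w + vir_bracket y w"
  "vir_bracket (a *\<^sub>C x) w = a *\<^sub>C vir_bracket x w"
  "vir_bracket w (x + y) = vir_bracket w x + vir_bracket w y"
  "vir_bracket w (a *\<^sub>C x) = a *\<^sub>C vir_bracket w x"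
     apply (simp_all add: vir_bracket_def plus_vir.rep_eq scaleC_vir.rep_eq lin_ext_add lin_ext_map_mult)
   apply (simp_all add: lin_ext_def scaleC_add_right sum.distrib complex_vec.scale_sum_right
      scaleC_scaleC mult_ac)
  done

lemma vir_bracket_zero: "vir_bracket 0 x = 0" "vir_bracket x 0 = 0"
  using vir_bracket_bilinear(2)[of 0 0 x] vir_bracket_bilinear(4)[of x 0 0] by simp_all

lemma vir_bracket_basis: "vir_bracket (vir_basis i) (vir_basis j) = basis_bracket i j"
  by (simp add: vir_bracket_def vir_coords_basis scaleC_one)

lemma vir_bracket_gens:
  "vir_bracket (vd k) (vd j) =
     of_int (k - j) *\<^sub>C vd (k + j) + (if j = - k then (of_int (k^3 - k) / 12) *\<^sub>C vz else 0)"
  "vir_bracket vz x = 0" "vir_bracket x vz = 0"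
proof -
  show "vir_bracket (vd k) (vd j) =
     of_int (k - j) *\<^sub>C vd (k + j) + (if j = - k then (of_int (k^3 - k) / 12) *\<^sub>C vz else 0)"
    using vir_bracket_basis[of "Vir k" "Vir j"] by simp
  show "vir_bracket vz x = 0" "vir_bracket x vz = 0"
  proof (induction x rule: vir_induct)
    case (basis c i)
    show "vir_bracket vz (c *\<^sub>C vir_basis i) = 0"
      using vir_bracket_basis[of Cen i] by (cases i) (simp_all add: vir_bracket_bilinear)
    show "vir_bracket (c *\<^sub>C vir_basis i) vz = 0"
      using vir_bracket_basis[of i Cen] by (cases i) (simp_all add: vir_bracket_bilinear)
  qed (simp_all add: vir_bracket_bilinear vir_bracket_zero)
qed

lemma vir_bracket_anti: "vir_bracket x y = - vir_bracket y x"
proof (induction x rule: vir_induct)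
  case (basis c i)
  show ?case
  proof (induction y rule: vir_induct)
    case (basis d j)
    have "basis_bracket i j = - basis_bracket j i"
    proof (cases i; cases j)
      fix k l assume ij: "i = Vir k" "j = Vir l"
      have 1: "complex_of_int (k - l) *\<^sub>C vd (k + l) = - (complex_of_int (l - k) *\<^sub>C vd (l + k))"
        by (simp add: add.commute complex_vec.scale_left_diff_distrib)
      have "complex_of_int (k^3 - k) / 12 = - (complex_of_int (l^3 - l) / 12)" if "l = - k"
        using that by (simp add: field_simps)
      then have 2: "(if l = - k then (complex_of_int (k^3 - k) / 12) *\<^sub>C vz else 0)
          = - (if k = - l then (complex_of_int (l^3 - l) / 12) *\<^sub>C vz else 0)"
        by (auto simp del: of_int_diff of_int_power)
      show ?thesis
        unfolding ij basis_bracket.simps 1 2 by simp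
    qed simp_all
    then show ?case
      by (simp add: vir_bracket_bilinear vir_bracket_basis scaleC_scaleC mult.commute)
  qed (simp_all add: vir_bracket_bilinear vir_bracket_zero scaleC_add_right)
qed (simp_all add: vir_bracket_bilinear vir_bracket_zero)

lemma vir_jacobi_vd:
  "vir_bracket (vd k) (vir_bracket (vd l) (vd m)) + vir_bracket (vd l) (vir_bracket (vd m) (vd k))
     + vir_bracket (vd m) (vir_bracket (vd k) (vd l)) = 0"
proof -
  define c where "c = (\<lambda>k l m. if k + l + m = 0 then complex_of_int ((l - m) * (k^3 - k)) / 12 else 0)"
  have *: "vir_bracket (vd k) (vir_bracket (vd l) (vd m)) =
      complex_of_int ((l - m) * (k - (l + m))) *\<^sub>C vd (k + l + m) + c k l m *\<^sub>C vz" for k l m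
    by (auto simp: c_def vir_bracket_gens vir_bracket_bilinear vir_bracket_zero scaleC_add_right
        scaleC_scaleC add.assoc)
  have "(l - m) * (k^3 - k) + (m - k) * (l^3 - l) + (k - l) * (m^3 - m) = 0" if "m = - k - l"
    unfolding that by (simp add: algebra_simps power3_eq_cube)
  then have "complex_of_int ((l - m) * (k^3 - k) + (m - k) * (l^3 - l) + (k - l) * (m^3 - m)) = 0"
    if "k + l + m = 0"
    using that by (simp del: of_int_add of_int_mult of_int_diff of_int_power add: eq_neg_iff_add_eq_0 algebra_simps)
  then have c: "c k l m + c l m k + c m k l = 0"
    by (auto simp: c_def add_ac add_divide_distrib[symmetric])
  have d: "complex_of_int ((l - m) * (k - (l + m))) + complex_of_int ((m - k) * (l - (m + k)))
      + complex_of_int ((k - l) * (m - (k + l))) = 0"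
    by (simp add: algebra_simps)
  have "vir_bracket (vd k) (vir_bracket (vd l) (vd m)) + vir_bracket (vd l) (vir_bracket (vd m) (vd k))
     + vir_bracket (vd m) (vir_bracket (vd k) (vd l)) =
     (complex_of_int ((l - m) * (k - (l + m))) + complex_of_int ((m - k) * (l - (m + k)))
      + complex_of_int ((k - l) * (m - (k + l)))) *\<^sub>C vd (k + l + m)
     + (c k l m + c l m k + c m k l) *\<^sub>C vz"
    unfolding * scaleC_add_left by (simp only: add_ac)
  then show ?thesis unfolding c d by simp
qed

lemma vir_jacobi:
  "vir_bracket x (vir_bracket y w) + vir_bracket y (vir_bracket w x)
     + vir_bracket w (vir_bracket x y) = 0"
proof (induction x rule: vir_induct)
  case (basis a i)
  show ?case
  proof (induction y rule: vir_induct)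
    case (basis b j)
    show ?case
    proof (induction w rule: vir_induct)
      case (basis c k)
      have *: "vir_bracket (vir_basis i) (vir_bracket (vir_basis j) (vir_basis k))
        + vir_bracket (vir_basis j) (vir_bracket (vir_basis k) (vir_basis i))
        + vir_bracket (vir_basis k) (vir_bracket (vir_basis i) (vir_basis j)) = 0"
        using vir_jacobi_vd by (cases i; cases j; cases k) (simp_all add: vir_bracket_gens vir_bracket_zero)
      show ?case
        using arg_cong[OF *, of "\<lambda>v. (a * b * c) *\<^sub>C v"]
        by (simp add: vir_bracket_bilinear scaleC_scaleC scaleC_add_right mult_ac)
    next
      case (add u v)
      from arg_cong2[OF add.IH, of "(+)"] show ?case by (simp add: vir_bracket_bilinear algebra_simps)
    qed (simp_all add: vir_bracket_bilinear vir_bracket_zero)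
  next
    case (add u v)
    from arg_cong2[OF add.IH, of "(+)"] show ?case by (simp add: vir_bracket_bilinear algebra_simps)
  qed (simp_all add: vir_bracket_bilinear vir_bracket_zero)
next
  case (add u v)
  from arg_cong2[OF add.IH, of "(+)"] show ?case by (simp add: vir_bracket_bilinear algebra_simps)
qed (simp_all add: vir_bracket_bilinear vir_bracket_zero)

instantiation vir :: complex_lie_algebra
begin

definition lie_bracket_vir :: "vir \<Rightarrow> vir \<Rightarrow> vir" where
  "lie_bracket_vir = vir_bracket"

instance
proof
  fix x :: vir
  have "vir_bracket x x + vir_bracket x x = 0"
    using vir_bracket_anti[of x x] by (metis add.right_inverse)
  then have "(2::complex) *\<^sub>C vir_bracket x x = 0"
    using scaleC_add_left[of 1 1 "vir_bracket x x"] by (simp add: scaleC_one)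
  then show "lie_bracket x x = 0" by (simp add: lie_bracket_vir_def)
qed (simp_all add: lie_bracket_vir_def vir_bracket_bilinear vir_jacobi)

end

lemma vir_relations:
  "lie_bracket (vd k) (vd j) =
     of_int (k - j) *\<^sub>C vd (k + j) + (if j = - k then (of_int (k^3 - k) / 12) *\<^sub>C vz else 0)"
  "lie_bracket vz x = 0" "lie_bracket x vz = 0"
  by (simp_all only: lie_bracket_vir_def vir_bracket_gens)

definition nplus :: "vir set" where
  "nplus = complex_vec.span {vd k | k. k > 0}"

definition nplus_z :: "vir set" where
  "nplus_z = {x + c *\<^sub>C vz | x c. x \<in> nplus}"

lemma nplus_closed:
  "0 \<in> nplus" "x \<in> nplus \<Longrightarrow> y \<in> nplus \<Longrightarrow> x + y \<in> nplus"
  "x \<in> nplus \<Longrightarrow> y \<in> nplus \<Longrightarrow> x - y \<in> nplus"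
  "x \<in> nplus \<Longrightarrow> - x \<in> nplus" "x \<in> nplus \<Longrightarrow> c *\<^sub>C x \<in> nplus"
  by (simp_all add: nplus_def complex_vec.span_zero complex_vec.span_add complex_vec.span_diff
      complex_vec.span_neg complex_vec.span_scale)

lemma nplus_bracket:
  assumes "x \<in> nplus" "y \<in> nplus"
  shows "lie_bracket x y \<in> nplus"
proof -
  have 1: "lie_bracket (vd k) y \<in> nplus" if "k > 0" for k
    using assms(2) unfolding nplus_def
  proof (induction y rule: complex_vec.span_induct_alt)
    case base
    show ?case
      by (simp add: lie_bracket_vir_def vir_bracket_zero complex_vec.span_zero)
  next
    case (step c y v)
    then obtain j where j: "y = vd j" "j > 0" by auto
    have "lie_bracket (vd k) (vd j) = of_int (k - j) *\<^sub>C vd (k + j)"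
      using that j by (simp add: vir_relations)
    moreover have "vd (k + j) \<in> complex_vec.span {vd k | k. k > 0}"
      using that j by (intro complex_vec.span_base) auto
    ultimately show ?case
      using step j by (simp add: lie_add_right lie_scaleC_right complex_vec.span_add
          complex_vec.span_scale)
  qed
  show ?thesis
    using assms(1) unfolding nplus_def
  proof (induction x rule: complex_vec.span_induct_alt)
    case base
    show ?case
      by (simp add: lie_bracket_vir_def vir_bracket_zero complex_vec.span_zero)
  next
    case (step c x v)
    then show ?case
      using 1 by (auto simp: nplus_def lie_add_left lie_scaleC_left complex_vec.span_add
          complex_vec.span_scale)
  qed
qed

lemma nplus_zI: "x \<in> nplus \<Longrightarrow> x + c *\<^sub>C vz \<in> nplus_z"
  by (auto simp: nplus_z_def)

lemma nplus_in_nplus_z: "x \<in> nplus \<Longrightarrow> x \<in> nplus_z"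
  using nplus_zI[of x 0] by simp

lemma vz_in_nplus_z: "vz \<in> nplus_z"
  using nplus_zI[OF nplus_closed(1), of 1] by (simp add: scaleC_one)

lemma nplus_z_closed:
  assumes "x \<in> nplus_z" "y \<in> nplus_z"
  shows "x + y \<in> nplus_z" "- x \<in> nplus_z" "x - y \<in> nplus_z" "c *\<^sub>C x \<in> nplus_z"
    "lie_bracket x y \<in> nplus_z"
proof -
  obtain u a where x: "x = u + a *\<^sub>C vz" "u \<in> nplus" using assms(1) by (auto simp: nplus_z_def)
  obtain v b where y: "y = v + b *\<^sub>C vz" "v \<in> nplus" using assms(2) by (auto simp: nplus_z_def)
  show "x + y \<in> nplus_z"
    using nplus_zI[OF nplus_closed(2)[OF x(2) y(2)], of "a + b"] x(1) y(1)
    by (simp add: scaleC_add_left algebra_simps)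
  show "- x \<in> nplus_z"
    using nplus_zI[OF nplus_closed(4)[OF x(2)], of "- a"] x(1) by simp
  show "x - y \<in> nplus_z"
    using nplus_zI[OF nplus_closed(3)[OF x(2) y(2)], of "a - b"] x(1) y(1)
    by (simp add: complex_vec.scale_left_diff_distrib algebra_simps)
  show "c *\<^sub>C x \<in> nplus_z"
    using nplus_zI[OF nplus_closed(5)[OF x(2)], of c "c * a"] x(1)
    by (simp add: scaleC_add_right scaleC_scaleC)
  show "lie_bracket x y \<in> nplus_z"
    using nplus_in_nplus_z[OF nplus_bracket[OF x(2) y(2)]] x(1) y(1)
    by (simp add: lie_add_left lie_add_right lie_scaleC_left lie_scaleC_right vir_relations)
qed

typedef vir_nz = nplus_z
  morphisms nz_incl Abs_nz
  using vz_in_nplus_z by blast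

setup_lifting type_definition_vir_nz

instantiation vir_nz :: complex_lie_algebra
begin

lift_definition zero_vir_nz :: vir_nz is 0 by (rule nplus_in_nplus_z, rule nplus_closed)
lift_definition plus_vir_nz :: "vir_nz \<Rightarrow> vir_nz \<Rightarrow> vir_nz" is "(+)" by (rule nplus_z_closed)
lift_definition minus_vir_nz :: "vir_nz \<Rightarrow> vir_nz \<Rightarrow> vir_nz" is "(-)" by (rule nplus_z_closed)
lift_definition uminus_vir_nz :: "vir_nz \<Rightarrow> vir_nz" is uminus by (rule nplus_z_closed)
lift_definition scaleC_vir_nz :: "complex \<Rightarrow> vir_nz \<Rightarrow> vir_nz" is scaleC by (rule nplus_z_closed)
lift_definition lie_bracket_vir_nz :: "vir_nz \<Rightarrow> vir_nz \<Rightarrow> vir_nz" is lie_bracket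
  by (rule nplus_z_closed)

instance
  by standard (transfer; simp add: scaleC_add_left scaleC_add_right scaleC_scaleC scaleC_one
      lie_add_left lie_add_right lie_scaleC_left lie_scaleC_right lie_self lie_jacobi)+

end

definition nplus_char :: "(vir \<Rightarrow> complex) \<Rightarrow> bool" where
  "nplus_char \<psi> \<longleftrightarrow>
     (\<forall>x\<in>nplus. \<forall>y\<in>nplus. \<psi> (x + y) = \<psi> x + \<psi> y) \<and>
     (\<forall>c. \<forall>x\<in>nplus. \<psi> (c *\<^sub>C x) = c * \<psi> x) \<and>
     (\<forall>x\<in>nplus. \<forall>y\<in>nplus. \<psi> (lie_bracket x y) = 0)"

text \<open>The character of $n^+ + C z$ given by \<open>\<psi>\<close> on $n^+$ and \<open>\<xi>\<close> on \<open>z\<close>;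
  only the values of \<open>\<psi>\<close> on $n^+$ are used.\<close>

definition nz_char :: "(vir \<Rightarrow> complex) \<Rightarrow> complex \<Rightarrow> vir_nz \<Rightarrow> complex" where
  "nz_char \<psi> \<xi> y =
     (let c = Poly_Mapping.lookup (vir_coords (nz_incl y)) Cen
      in \<psi> (nz_incl y - c *\<^sub>C vz) + c * \<xi>)"

lemma nplus_coord_Cen: "x \<in> nplus \<Longrightarrow> Poly_Mapping.lookup (vir_coords x) Cen = 0"
  unfolding nplus_def
  by (induction x rule: complex_vec.span_induct_alt)
    (auto simp: zero_vir.rep_eq plus_vir.rep_eq scaleC_vir.rep_eq vd.rep_eq lookup_add lookup_single)

lemma nz_char_eq:
  assumes "x \<in> nplus" "nz_incl y = x + c *\<^sub>C vz"
  shows "nz_char \<psi> \<xi> y = \<psi> x + c * \<xi>"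
proof -
  have "Poly_Mapping.lookup (vir_coords (nz_incl y)) Cen = c"
    using nplus_coord_Cen[OF assms(1)] assms(2)
    by (simp add: plus_vir.rep_eq scaleC_vir.rep_eq vz.rep_eq lookup_add)
  then show ?thesis using assms(2) by (simp add: nz_char_def)
qed

lemma lie_hom_nz_char:
  assumes "nplus_char \<psi>"
  shows "lie_hom_assoc (nz_char \<psi> \<xi>)"
proof -
  have dec: "\<exists>u\<in>nplus. \<exists>a. nz_incl x = u + a *\<^sub>C vz" for x
    using nz_incl[of x] by (auto simp: nplus_z_def)
  have "nz_char \<psi> \<xi> (x + y) = nz_char \<psi> \<xi> x + nz_char \<psi> \<xi> y"
    "nz_char \<psi> \<xi> (lie_bracket x y) = 0" for x y
  proof -
    obtain u a v b where *: "u \<in> nplus" "v \<in> nplus" "nz_incl x = u + a *\<^sub>C vz" "nz_incl y = v + b *\<^sub>C vz"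
      using dec[of x] dec[of y] by auto
    have "nz_incl (x + y) = (u + v) + (a + b) *\<^sub>C vz"
      by (simp add: plus_vir_nz.rep_eq * scaleC_add_left algebra_simps)
    from nz_char_eq[OF nplus_closed(2)[OF *(1,2)] this, of \<psi> \<xi>]
    show "nz_char \<psi> \<xi> (x + y) = nz_char \<psi> \<xi> x + nz_char \<psi> \<xi> y"
      using assms *(1,2) unfolding nz_char_eq[OF *(1,3)] nz_char_eq[OF *(2,4)]
      by (simp add: nplus_char_def algebra_simps)
    have "nz_incl (lie_bracket x y) = lie_bracket u v + 0 *\<^sub>C vz"
      by (simp add: lie_bracket_vir_nz.rep_eq * lie_add_left lie_add_right lie_scaleC_left
          lie_scaleC_right vir_relations)
    from nz_char_eq[OF nplus_bracket[OF *(1,2)] this, of \<psi> \<xi>]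
    show "nz_char \<psi> \<xi> (lie_bracket x y) = 0"
      using assms * by (simp add: nplus_char_def)
  qed
  moreover have "nz_char \<psi> \<xi> (c *\<^sub>C x) = c *\<^sub>C nz_char \<psi> \<xi> x" for c x
  proof -
    obtain u a where *: "u \<in> nplus" "nz_incl x = u + a *\<^sub>C vz"
      using dec[of x] by auto
    have "nz_incl (c *\<^sub>C x) = c *\<^sub>C u + (c * a) *\<^sub>C vz"
      by (simp add: scaleC_vir_nz.rep_eq * scaleC_add_right scaleC_scaleC)
    from nz_char_eq[OF nplus_closed(5)[OF *(1)] this, of \<psi> \<xi>]
    show ?thesis
      using assms *(1) unfolding nz_char_eq[OF *]
      by (simp add: nplus_char_def scaleC_complex_def algebra_simps)
  qed
  ultimately show ?thesis by (simp add: lie_hom_assoc_def linC_def)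
qed

lemma lie_hom_nz_incl: "lie_hom_assoc (\<lambda>y. uea_of (nz_incl y))"
  using lie_hom_uea_of
  by (auto simp: lie_hom_assoc_def linC_def plus_vir_nz.rep_eq scaleC_vir_nz.rep_eq
      lie_bracket_vir_nz.rep_eq)

text \<open>The ring homomorphism from $U(n^+ + C z)$ to $U(g)$ induced by the inclusion.\<close>

definition uea_incl :: "vir_nz uea \<Rightarrow> vir uea" where
  "uea_incl = uea_lift (\<lambda>y. uea_of (nz_incl y))"

section \<open>Tensor products over a ring\<close>

text \<open>The tensor product of a right module \<open>'m\<close> with a left module \<open>'n\<close> over the ring \<open>'r\<close>,
  with actions \<open>rm\<close> and \<open>lm\<close>, is the free abelian group on pairs modulo this congruence.\<close>

definition tensor_kernel ::
  "('m::ab_group_add \<Rightarrow> 'r \<Rightarrow> 'm) \<Rightarrow> ('r \<Rightarrow> 'n::ab_group_add \<Rightarrow> 'n) \<Rightarrow> ('m \<times> 'n \<Rightarrow>\<^sub>0 int) set" where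
  "tensor_kernel rm lm = group_closure
     ({frag_of (m + m', n) - frag_of (m, n) - frag_of (m', n) | m m' n. True}
    \<union> {frag_of (m, n + n') - frag_of (m, n) - frag_of (m, n') | m n n'. True}
    \<union> {frag_of (rm m r, n) - frag_of (m, lm r n) | m r n. True})"

definition tensor_rel ::
  "('m::ab_group_add \<Rightarrow> 'r \<Rightarrow> 'm) \<Rightarrow> ('r \<Rightarrow> 'n::ab_group_add \<Rightarrow> 'n) \<Rightarrow> ('m \<times> 'n \<Rightarrow>\<^sub>0 int) rel" where
  "tensor_rel rm lm = {(a, b). a - b \<in> tensor_kernel rm lm}"

lemma equiv_tensor_rel: "equiv UNIV (tensor_rel rm lm)"
proof (rule equivI)
  show "refl (tensor_rel rm lm)" by (simp add: refl_on_def tensor_rel_def tensor_kernel_def)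
  show "sym (tensor_rel rm lm)"
    unfolding sym_def tensor_rel_def tensor_kernel_def
    by (metis (no_types, lifting) case_prod_conv group_closure_minus_iff mem_Collect_eq minus_diff_eq)
  show "trans (tensor_rel rm lm)"
  proof (rule transI)
    fix a b c
    assume "(a, b) \<in> tensor_rel rm lm" "(b, c) \<in> tensor_rel rm lm"
    then have "(a - b) + (b - c) \<in> tensor_kernel rm lm"
      unfolding tensor_rel_def tensor_kernel_def by (intro group_closure_add) simp_all
    then show "(a, c) \<in> tensor_rel rm lm" by (simp add: tensor_rel_def)
  qed
qed simp

section \<open>Modules over a Lie algebra\<close>

definition lie_module :: "('l::complex_lie_algebra \<Rightarrow> 'v::complex_vector \<Rightarrow> 'v) \<Rightarrow> bool" where
  "lie_module act \<longleftrightarrow>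
     (\<forall>x. linC (act x)) \<and> (\<forall>v. linC (\<lambda>x. act x v)) \<and>
     (\<forall>x y v. act (lie_bracket x y) v = act x (act y v) - act y (act x v))"

definition lie_submodule :: "('l::complex_lie_algebra \<Rightarrow> 'v::complex_vector \<Rightarrow> 'v) \<Rightarrow> 'v set \<Rightarrow> bool" where
  "lie_submodule act S \<longleftrightarrow> complex_vec.subspace S \<and> (\<forall>x. \<forall>v\<in>S. act x v \<in> S)"

text \<open>Module structures on an explicit carrier, needed because \<open>L(\<psi>, \<xi>)\<close> depends on
  parameters and hence is not a type.\<close>

record ('l, 'm) carrier_module =
  mcarrier :: "'m set"
  madd :: "'m \<Rightarrow> 'm \<Rightarrow> 'm"
  mscale :: "complex \<Rightarrow> 'm \<Rightarrow> 'm"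
  mact :: "'l \<Rightarrow> 'm \<Rightarrow> 'm"

definition module_iso ::
  "('l \<Rightarrow> 'v::complex_vector \<Rightarrow> 'v) \<Rightarrow> ('l, 'm) carrier_module \<Rightarrow> ('v \<Rightarrow> 'm) \<Rightarrow> bool" where
  "module_iso act M f \<longleftrightarrow>
     bij_betw f UNIV (mcarrier M) \<and>
     (\<forall>v w. f (v + w) = madd M (f v) (f w)) \<and>
     (\<forall>c v. f (c *\<^sub>C v) = mscale M c (f v)) \<and>
     (\<forall>x v. f (act x v) = mact M x (f v))"

section \<open>The induced module \<open>L(\<psi>, \<xi>)\<close>\<close>

definition whittaker_rel ::
  "(vir \<Rightarrow> complex) \<Rightarrow> complex \<Rightarrow> (vir uea \<times> complex \<Rightarrow>\<^sub>0 int) rel" where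
  "whittaker_rel \<psi> \<xi> =
     tensor_rel (\<lambda>u r. u * uea_incl r) (\<lambda>r c. uea_lift (nz_char \<psi> \<xi>) r * c)"

definition left_mult :: "vir uea \<Rightarrow> (vir uea \<times> complex \<Rightarrow>\<^sub>0 int) \<Rightarrow> (vir uea \<times> complex \<Rightarrow>\<^sub>0 int)" where
  "left_mult u = frag_extend (\<lambda>(v, c). frag_of (u * v, c))"

definition whittaker_L ::
  "(vir \<Rightarrow> complex) \<Rightarrow> complex \<Rightarrow> (vir, (vir uea \<times> complex \<Rightarrow>\<^sub>0 int) set) carrier_module" where
  "whittaker_L \<psi> \<xi> =
     (let R = whittaker_rel \<psi> \<xi> in
      \<lparr>mcarrier = UNIV // R,
       madd = (\<lambda>X Y. \<Union>a\<in>X. \<Union>b\<in>Y. R `` {a + b}),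
       mscale = (\<lambda>c X. \<Union>a\<in>X. R `` {left_mult (c *\<^sub>C 1) a}),
       mact = (\<lambda>x X. \<Union>a\<in>X. R `` {left_mult (uea_of x) a})\<rparr>)"

lemma whittaker_rel_left_mult:
  assumes "(a, b) \<in> whittaker_rel \<psi> \<xi>"
  shows "(left_mult u a, left_mult u b) \<in> whittaker_rel \<psi> \<xi>"
proof -
  let ?K = "tensor_kernel (\<lambda>u r. u * uea_incl r) (\<lambda>r c. uea_lift (nz_char \<psi> \<xi>) r * c)"
  have "left_mult u d \<in> ?K" if "d \<in> ?K" for d
    using that unfolding tensor_kernel_def
  proof (induction rule: group_closure.induct)
    case (base s)
    then consider "s = 0"
      | m m' n where "s = frag_of (m + m', n) - frag_of (m, n) - frag_of (m', n)"
      | m n n' where "s = frag_of (m, n + n') - frag_of (m, n) - frag_of (m, n')"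
      | m r n where "s = frag_of (m * uea_incl r, n) - frag_of (m, uea_lift (nz_char \<psi> \<xi>) r * n)"
      by blast
    then show ?case
    proof cases
      case 1
      then show ?thesis by (simp add: left_mult_def)
    next
      case 2
      then have "left_mult u s = frag_of (u * m + u * m', n) - frag_of (u * m, n) - frag_of (u * m', n)"
        by (simp add: left_mult_def frag_extend_diff distrib_left)
      then show ?thesis by (intro group_closure.base) blast
    next
      case 3
      then have "left_mult u s = frag_of (u * m, n + n') - frag_of (u * m, n) - frag_of (u * m, n')"
        by (simp add: left_mult_def frag_extend_diff)
      then show ?thesis by (intro group_closure.base) blast
    next
      case 4
      then have "left_mult u s =
          frag_of ((u * m) * uea_incl r, n) - frag_of (u * m, uea_lift (nz_char \<psi> \<xi>) r * n)"
        by (simp add: left_mult_def frag_extend_diff mult.assoc)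
      then show ?thesis by (intro group_closure.base) blast
    qed
  next
    case (diff s t)
    then show ?case by (simp add: left_mult_def frag_extend_diff group_closure.diff)
  qed
  then show ?thesis
    using assms by (simp add: whittaker_rel_def tensor_rel_def left_mult_def frag_extend_diff[symmetric])
qed

lemma whittaker_rel_add:
  assumes "(a, a') \<in> whittaker_rel \<psi> \<xi>" "(b, b') \<in> whittaker_rel \<psi> \<xi>"
  shows "(a + b, a' + b') \<in> whittaker_rel \<psi> \<xi>"
  using assms unfolding whittaker_rel_def tensor_rel_def tensor_kernel_def
  by (simp add: add_diff_add group_closure_add)

lemma equiv_whittaker_rel: "equiv UNIV (whittaker_rel \<psi> \<xi>)"
  unfolding whittaker_rel_def by (rule equiv_tensor_rel)

lemma whittaker_L_simps:
  "mcarrier (whittaker_L \<psi> \<xi>) = UNIV // whittaker_rel \<psi> \<xi>"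
  "madd (whittaker_L \<psi> \<xi>) (whittaker_rel \<psi> \<xi> `` {a}) (whittaker_rel \<psi> \<xi> `` {b})
     = whittaker_rel \<psi> \<xi> `` {a + b}"
  "mscale (whittaker_L \<psi> \<xi>) c (whittaker_rel \<psi> \<xi> `` {a})
     = whittaker_rel \<psi> \<xi> `` {left_mult (c *\<^sub>C 1) a}"
  "mact (whittaker_L \<psi> \<xi>) x (whittaker_rel \<psi> \<xi> `` {a})
     = whittaker_rel \<psi> \<xi> `` {left_mult (uea_of x) a}"
proof -
  let ?R = "whittaker_rel \<psi> \<xi>"
  note E = equiv_whittaker_rel[of \<psi> \<xi>]
  have *: "(\<Union>a'\<in>?R `` {a}. ?R `` {left_mult u a'}) = ?R `` {left_mult u a}" for u a
    by (rule UN_equiv_class[OF E])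
      (auto simp: congruent_def intro!: equiv_class_eq[OF E] whittaker_rel_left_mult)
  show "mcarrier (whittaker_L \<psi> \<xi>) = UNIV // ?R" by (simp add: whittaker_L_def Let_def)
  show "madd (whittaker_L \<psi> \<xi>) (?R `` {a}) (?R `` {b}) = ?R `` {a + b}"
    unfolding whittaker_L_def Let_def carrier_module.simps
    by (rule UN_equiv_class2[OF E E])
      (auto simp: congruent2_def intro!: equiv_class_eq[OF E] whittaker_rel_add)
  show "mscale (whittaker_L \<psi> \<xi>) c (?R `` {a}) = ?R `` {left_mult (c *\<^sub>C 1) a}"
    "mact (whittaker_L \<psi> \<xi>) x (?R `` {a}) = ?R `` {left_mult (uea_of x) a}"
    by (simp_all only: whittaker_L_def Let_def carrier_module.simps *)
qed

text \<open>The canonical generator \<open>1 \<otimes> 1\<close> is a Whittaker vector of type \<open>\<psi>\<close> with central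
  character \<open>\<xi>\<close>.\<close>

lemma whittaker_L_generator:
  fixes \<psi> \<xi>
  defines "w \<equiv> \<lambda>c. whittaker_rel \<psi> \<xi> `` {frag_of (1, c)}"
  assumes "nplus_char \<psi>"
  shows "x \<in> nplus \<Longrightarrow> mact (whittaker_L \<psi> \<xi>) x (w 1) = w (\<psi> x)"
    and "mact (whittaker_L \<psi> \<xi>) vz (w 1) = w \<xi>"
    and "mscale (whittaker_L \<psi> \<xi>) c (w 1) = w c"
proof -
  note E = equiv_whittaker_rel[of \<psi> \<xi>]
  note hom = uea_lift_simps[OF lie_hom_nz_char[OF assms(2), of \<xi>]]
    and hom' = uea_lift_simps[OF lie_hom_nz_incl]
  have rel: "(frag_of (uea_incl r, 1), frag_of (1, uea_lift (nz_char \<psi> \<xi>) r)) \<in> whittaker_rel \<psi> \<xi>"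
    for r
  proof -
    have "frag_of (1 * uea_incl r, 1) - frag_of (1, uea_lift (nz_char \<psi> \<xi>) r * 1)
        \<in> tensor_kernel (\<lambda>u r. u * uea_incl r) (\<lambda>r c. uea_lift (nz_char \<psi> \<xi>) r * c)"
      unfolding tensor_kernel_def by (rule group_closure.base) blast
    then show ?thesis by (simp add: whittaker_rel_def tensor_rel_def)
  qed
  have act: "mact (whittaker_L \<psi> \<xi>) (nz_incl y) (w 1) = w (nz_char \<psi> \<xi> y)" for y
    using rel[of "uea_of y"] unfolding w_def whittaker_L_simps
    by (intro equiv_class_eq[OF E]) (simp add: left_mult_def uea_incl_def hom hom')
  show "mact (whittaker_L \<psi> \<xi>) x (w 1) = w (\<psi> x)" if "x \<in> nplus"
    using act[of "Abs_nz x"] nz_char_eq[OF that, of "Abs_nz x" 0 \<psi> \<xi>]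
    by (simp add: Abs_nz_inverse nplus_in_nplus_z that)
  have "\<psi> 0 = 0"
    using assms(2) nplus_closed(1) unfolding nplus_char_def by (metis complex_vec.scale_zero_left mult_zero_left)
  then show "mact (whittaker_L \<psi> \<xi>) vz (w 1) = w \<xi>"
    using act[of "Abs_nz vz"] nz_char_eq[OF nplus_closed(1), of "Abs_nz vz" 1 \<psi> \<xi>]
    by (simp add: Abs_nz_inverse vz_in_nplus_z scaleC_one)
  show "mscale (whittaker_L \<psi> \<xi>) c (w 1) = w c"
    using rel[of "c *\<^sub>C 1"] unfolding w_def whittaker_L_simps
    by (intro equiv_class_eq[OF E])
      (simp add: left_mult_def uea_incl_def hom hom' scaleC_complex_def)
qed

section \<open>The categories \<open>W\<close> and \<open>W(\<psi>)\<close>\<close>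

text \<open>The subspace $U(n^+) v$; the empty product gives \<open>v\<close> itself.\<close>

definition nplus_orbit :: "(vir \<Rightarrow> 'v::complex_vector \<Rightarrow> 'v) \<Rightarrow> 'v \<Rightarrow> 'v set" where
  "nplus_orbit act v = complex_vec.span {foldr act xs v | xs. set xs \<subseteq> nplus}"

definition fin_dim :: "'v::complex_vector set \<Rightarrow> bool" where
  "fin_dim S \<longleftrightarrow> (\<exists>B. finite B \<and> S = complex_vec.span B)"

text \<open>The bound on \<open>k\<close> may depend on both the vector and the element of \<open>n\<^sup>+\<close>.\<close>

definition psi_part :: "(vir \<Rightarrow> complex) \<Rightarrow> (vir \<Rightarrow> 'v::complex_vector \<Rightarrow> 'v) \<Rightarrow> 'v set \<Rightarrow> 'v set" where
  "psi_part \<psi> act S =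
     {v \<in> S. \<forall>x\<in>nplus. \<forall>\<^sub>F k in sequentially. ((\<lambda>w. act x w - \<psi> x *\<^sub>C w) ^^ k) v = 0}"

text \<open>Here \<open>S\<close> is a submodule of an ambient module, regarded as a module in its own right; the module
  itself is the case \<open>S = UNIV\<close>.\<close>

definition in_W :: "(vir \<Rightarrow> 'v::complex_vector \<Rightarrow> 'v) \<Rightarrow> 'v set \<Rightarrow> bool" where
  "in_W act S \<longleftrightarrow> lie_submodule act S \<and> (\<forall>v\<in>S. fin_dim (nplus_orbit act v))"

definition in_W_psi :: "(vir \<Rightarrow> complex) \<Rightarrow> (vir \<Rightarrow> 'v::complex_vector \<Rightarrow> 'v) \<Rightarrow> 'v set \<Rightarrow> bool" where
  "in_W_psi \<psi> act S \<longleftrightarrow> in_W act S \<and> S = psi_part \<psi> act S"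

definition simple_in_W_psi :: "(vir \<Rightarrow> complex) \<Rightarrow> (vir \<Rightarrow> 'v::complex_vector \<Rightarrow> 'v) \<Rightarrow> bool" where
  "simple_in_W_psi \<psi> act \<longleftrightarrow>
     lie_module act \<and> in_W_psi \<psi> act UNIV \<and> (UNIV :: 'v set) \<noteq> {0} \<and>
     (\<forall>S. in_W_psi \<psi> act S \<longrightarrow> S = {0} \<or> S = UNIV)"

end

theory Submission
  imports Defs "HOL-Library.Multiset" "HOL-Computational_Algebra.Fundamental_Theorem_Algebra"
begin

text \<open>
  Write \<open>d\<^sub>k\<close> also for the action of \<open>d\<^sub>k\<close> on the simple module \<open>V\<close>. Every vector of \<open>V\<close> that
  \<open>n\<^sup>+\<close> multiplies by \<open>\<psi>\<close> is called a Whittaker vector.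

  A nonzero Whittaker vector exists. On a finite-dimensional subspace \<open>U(n\<^sup>+) v\<close> the operator
  \<open>T = d\<^sub>1 - \<psi>(d\<^sub>1)\<close> is nilpotent, so a high power of \<open>ad T\<close> vanishes there; that power
  sends \<open>d\<^sub>k\<close> to a nonzero multiple of some \<open>d\<^sub>k\<^sub>+\<^sub>r\<close>, so all \<open>d\<^sub>k\<close> with \<open>k\<close> large kill the
  subspace. The finitely many remaining \<open>d\<^sub>k - \<psi>(d\<^sub>k)\<close> are locally nilpotent and can be killed
  one at a time, from the top index down
  (\<open>whittaker_vector_exists\<close>).

  The core is that \<open>V\<close> contains no unexpected relations: ordered monomials in
  \<open>d\<^sub>0, d\<^sub>-\<^sub>1, d\<^sub>-\<^sub>2, \<dots>\<close>, applied to Whittaker vectors, sum to zero only if all these Whittaker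
  vectors vanish (\<open>pbw_independent\<close>). Since \<open>\<psi>\<close> kills every \<open>d\<^sub>k\<close> with \<open>k \<ge> 3\<close> and
  \<open>\<psi> \<noteq> 0\<close>, there is a largest \<open>s\<close> with \<open>\<psi>(d\<^sub>s) \<noteq> 0\<close>, and \<open>s\<close> is \<open>1\<close> or \<open>2\<close>. As
  \<open>[d\<^sub>j\<^sub>+\<^sub>s, d\<^sub>-\<^sub>j] = (2j + s) d\<^sub>s\<close>, the operator \<open>d\<^sub>j\<^sub>+\<^sub>s - \<psi>(d\<^sub>j\<^sub>+\<^sub>s)\<close> acts on leading terms as the
  nonzero multiple \<open>(2j + s) \<psi>(d\<^sub>s)\<close> of the partial derivative in the variable \<open>d\<^sub>-\<^sub>j\<close>, where
  leading terms are taken first by weight and then by degree (\<open>lowering_monomial\<close>). A polynomial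
  all of whose partial derivatives vanish is constant, which gives the independence by induction on the degree.

  Independence forces the central element \<open>z\<close> to act by a scalar. For a nonzero Whittaker vector
  \<open>w\<close>, the space \<open>C[z] z w\<close> consists of Whittaker vectors and generates \<open>0\<close> or \<open>V\<close>; in the second
  case \<open>w\<close> itself lies in \<open>C[z] z w\<close>, because its expansion in monomials is unique. Either way a
  nonzero polynomial in \<open>z\<close> kills \<open>w\<close>, so \<open>z\<close> has an eigenvalue \<open>\<xi>\<close>, and
  the eigenspace is a submodule (\<open>center_acts_by_scalar\<close>).

  Finally \<open>u \<otimes> c \<mapsto> c u w\<close> is a well-defined map from \<open>L(\<psi>, \<xi>)\<close> onto \<open>V\<close>. Modulo the relations of
  \<open>L(\<psi>, \<xi>)\<close> every element is a combination of ordered monomials in the \<open>d\<^sub>k\<close> with \<open>k \<le> 0\<close>, and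
  these stay independent when applied to \<open>w\<close>, so the map is injective (\<open>uea_annihilator\<close>).
\<close>

section \<open>Linear maps and spans\<close>

lemma linC_zero: "linC f \<Longrightarrow> f 0 = 0"
  using linC_scaleC[of f 0 0] by simp

lemma linC_uminus: "linC f \<Longrightarrow> f (- x) = - f x"
  using linC_scaleC[of f "- 1" x] by simp

lemma linC_diff: "linC f \<Longrightarrow> f (x - y) = f x - f y"
  using linC_add[of f x "- y"] by (simp add: linC_uminus)

lemma linC_sum: "linC f \<Longrightarrow> f (sum g A) = (\<Sum>a\<in>A. f (g a))"
  by (induction A rule: infinite_finite_induct) (simp_all add: linC_zero linC_add)

lemma linC_compose: "linC f \<Longrightarrow> linC g \<Longrightarrow> linC (\<lambda>v. f (g v))"
  and linC_minus_scaleC: "linC f \<Longrightarrow> linC (\<lambda>v. f v - c *\<^sub>C v)"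
  by (simp_all add: linC_def algebra_simps complex_vec.scale_right_diff_distrib
      scaleC_add_right scaleC_scaleC mult.commute)

lemma linC_funpow: "linC f \<Longrightarrow> linC ((f :: 'v::complex_vector \<Rightarrow> 'v) ^^ n)"
  by (induction n) (auto simp: linC_def)

lemma linC_span_into:
  assumes "linC f" "complex_vec.subspace S" "\<And>b. b \<in> B \<Longrightarrow> f b \<in> S" "v \<in> complex_vec.span B"
  shows "f v \<in> S"
  using assms(4)
proof (induction v rule: complex_vec.span_induct_alt)
  case base
  then show ?case
    using assms(1,2) by (simp add: linC_zero complex_vec.subspace_0)
next
  case (step c x y)
  then show ?case
    using assms(1-3) by (simp add: linC_add linC_scaleC complex_vec.subspace_add complex_vec.subspace_scale)
qed

section \<open>The action of the enveloping algebra on a module\<close>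

text \<open>The enveloping algebra is generated by the Lie algebra, so an additive property that holds on scalars and
  survives left multiplication by Lie algebra elements holds everywhere.\<close>

lemma uea_induct [case_names scalar mult add]:
  assumes "\<And>c. P (c *\<^sub>C 1)" "\<And>x u. P u \<Longrightarrow> P (uea_of x * u)"
    "\<And>u v. P u \<Longrightarrow> P v \<Longrightarrow> P (u + v)"
  shows "P (u :: 'l::complex_lie_algebra uea)"
proof (induction u rule: uea.abs_induct)
  case (1 p)
  show ?case
  proof (induction p rule: poly_mapping_add_induct)
    case zero
    show ?case using assms(1)[of 0] by (simp add: zero_uea_def)
  next
    case (single k c)
    have "P (abs_uea (Poly_Mapping.single (Word l) c))" for l :: "'l list"
    proof (induction l)
      case Nil
      have "abs_uea (Poly_Mapping.single (Word []) c) = c *\<^sub>C (1 :: 'l uea)"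
        by (simp add: one_uea_def scaleC_uea.abs_eq free_const_def zero_free_monoid_def)
      then show ?case using assms(1) by simp
    next
      case (Cons x l)
      have "abs_uea (Poly_Mapping.single (Word (x # l)) c)
          = uea_of x * abs_uea (Poly_Mapping.single (Word l) c)"
        by (simp add: uea_of.abs_eq times_uea.abs_eq free_gen_def mult_single plus_free_monoid_def)
      then show ?case using assms(2)[OF Cons] by simp
    qed
    then show ?case by (cases k) simp
  next
    case (add p q)
    then show ?case using assms(3) by (simp add: plus_uea.abs_eq[symmetric])
  qed
qed

text \<open>The endomorphisms of a module form a ring with \<open>0 \<noteq> 1\<close> only if the module is nonzero, so the
  action of the enveloping algebra is not obtained from \<^const>\<open>uea_lift\<close>. Instead words of the free
  algebra act letter by letter, and the relators act by zero.\<close>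

definition free_act :: "('l \<Rightarrow> 'v::complex_vector \<Rightarrow> 'v) \<Rightarrow> 'l free_alg \<Rightarrow> 'v \<Rightarrow> 'v" where
  "free_act act p v = lin_ext (\<lambda>w. foldr act (letters w) v) p"

definition uea_act :: "('l::complex_lie_algebra \<Rightarrow> 'v::complex_vector \<Rightarrow> 'v) \<Rightarrow> 'l uea \<Rightarrow> 'v \<Rightarrow> 'v" where
  "uea_act act u v = free_act act (rep_uea u) v"

context
  fixes act :: "'l::complex_lie_algebra \<Rightarrow> 'v::complex_vector \<Rightarrow> 'v"
  assumes mod: "lie_module act"
begin

lemma lie_module_linC: "linC (act x)"
  and lie_module_linC_left: "linC (\<lambda>x. act x v)"
  and lie_module_bracket: "act (lie_bracket x y) v = act x (act y v) - act y (act x v)"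
  using mod by (auto simp: lie_module_def)

lemma linC_foldr: "linC (foldr act xs)"
proof (induction xs)
  case (Cons x xs)
  then show ?case using linC_compose[OF lie_module_linC Cons, of x] by (simp add: comp_def)
qed (simp add: linC_def)

lemma free_act_add: "free_act act (p + q) v = free_act act p v + free_act act q v"
  and free_act_diff: "free_act act (p - q) v = free_act act p v - free_act act q v"
  and free_act_zero: "free_act act 0 v = 0"
  and free_act_single: "free_act act (Poly_Mapping.single w c) v = c *\<^sub>C foldr act (letters w) v"
  by (simp_all add: free_act_def lin_ext_add lin_ext_diff)

lemma linC_free_act: "linC (free_act act p)"
  unfolding linC_def free_act_def lin_ext_def
  by (simp add: linC_add[OF linC_foldr] linC_scaleC[OF linC_foldr] sum.distrib scaleC_add_right
      scaleC_scaleC complex_vec.scale_sum_right mult.commute)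

lemma free_act_mult: "free_act act (p * q) v = free_act act p (free_act act q v)"
proof (induction p rule: poly_mapping_add_induct)
  case (single k c)
  show ?case
  proof (induction q rule: poly_mapping_add_induct)
    case (single l d)
    show ?case
      by (simp add: free_act_single mult_single plus_free_monoid_def linC_scaleC[OF linC_foldr]
          scaleC_scaleC)
  qed (simp_all add: free_act_zero free_act_add distrib_left linC_zero[OF linC_free_act]
      linC_add[OF linC_free_act])
qed (simp_all add: free_act_zero free_act_add distrib_right)

lemma free_act_gen: "free_act act (free_gen x) v = act x v"
  and free_act_const: "free_act act (free_const c) v = c *\<^sub>C v"
  by (simp_all add: free_gen_def free_const_def free_act_single scaleC_one zero_free_monoid_def)

lemma free_act_ideal:
  assumes "a \<in> uea_ideal"
  shows "free_act act a v = 0"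
proof -
  have "free_act act r v = 0" if "r \<in> uea_relators" for r v
    using that unfolding uea_relators_def
    by (auto simp: free_act_diff free_act_mult free_act_gen free_act_const lie_module_bracket
        linC_add[OF lie_module_linC_left] linC_scaleC[OF lie_module_linC_left])
  note * = this
  from assms show ?thesis
    unfolding uea_ideal_def
    by (induction arbitrary: v rule: group_closure.induct)
      (auto simp: * free_act_mult free_act_diff free_act_zero linC_zero[OF linC_free_act])
qed

lemma uea_act_abs: "uea_act act (abs_uea p) v = free_act act p v"
proof -
  have "rep_uea (abs_uea p) - p \<in> uea_ideal"
    by (simp add: uea.abs_eq_iff[symmetric] Quotient3_abs_rep[OF Quotient3_uea])
  from free_act_ideal[OF this] show ?thesis by (simp add: uea_act_def free_act_diff)
qed

lemma linC_uea_act: "linC (uea_act act u)"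
  using linC_free_act[of "rep_uea u"] by (simp add: linC_def uea_act_def)

lemma uea_act_simps:
  "uea_act act (uea_of x) v = act x v"
  "uea_act act (c *\<^sub>C u) v = c *\<^sub>C uea_act act u v"
  "uea_act act 1 v = v"
  "uea_act act (u + u') v = uea_act act u v + uea_act act u' v"
  "uea_act act (u * u') v = uea_act act u (uea_act act u' v)"
proof -
  show "uea_act act (uea_of x) v = act x v"
    by (simp add: uea_of.abs_eq uea_act_abs free_act_gen)
  show "uea_act act 1 v = v"
    using free_act_const[of 1 v]
    by (simp add: one_uea.abs_eq uea_act_abs free_const_def scaleC_one)
  show "uea_act act (u + u') v = uea_act act u v + uea_act act u' v"
    by (induction u rule: uea.abs_induct, induction u' rule: uea.abs_induct)
      (simp add: plus_uea.abs_eq uea_act_abs free_act_add)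
  show "uea_act act (u * u') v = uea_act act u (uea_act act u' v)"
    by (induction u rule: uea.abs_induct, induction u' rule: uea.abs_induct)
      (simp add: times_uea.abs_eq uea_act_abs free_act_mult)
  show "uea_act act (c *\<^sub>C u) v = c *\<^sub>C uea_act act u v"
    by (induction u rule: uea.abs_induct)
      (simp add: scaleC_uea.abs_eq uea_act_abs free_act_mult free_act_const)
qed

lemma linC_uea_act_left: "linC (\<lambda>u. uea_act act u v)"
  by (simp add: linC_def uea_act_simps)

end

lemma lie_module_uea: "lie_module (\<lambda>x (u :: 'l::complex_lie_algebra uea). uea_of x * u)"
  using lie_hom_uea_of[where 'a = 'l]
  by (auto simp: lie_module_def lie_hom_assoc_def linC_def distrib_left distrib_right
      left_diff_distrib mult.assoc mult_scaleC_left mult_scaleC_right)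

section \<open>Monomials in the non-positive generators\<close>

locale vir_module =
  fixes act :: "vir \<Rightarrow> 'v::complex_vector \<Rightarrow> 'v"
  assumes module: "lie_module act"
begin

abbreviation d :: "int \<Rightarrow> 'v \<Rightarrow> 'v" where "d k \<equiv> act (vd k)"

abbreviation z :: "'v \<Rightarrow> 'v" where "z \<equiv> act vz"

lemmas act_linC = lie_module_linC[OF module]
lemmas act_simps = linC_zero[OF act_linC] linC_add[OF act_linC] linC_diff[OF act_linC]
  linC_scaleC[OF act_linC] linC_uminus[OF act_linC]
lemmas act_left_simps = linC_zero[OF lie_module_linC_left[OF module]]
  linC_add[OF lie_module_linC_left[OF module]] linC_scaleC[OF lie_module_linC_left[OF module]]

definition vir_cocycle :: "int \<Rightarrow> int \<Rightarrow> complex" where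
  "vir_cocycle k l = (if l = - k then of_int (k^3 - k) / 12 else 0)"

lemma d_commute:
  "d k (d l v) = d l (d k v) + of_int (k - l) *\<^sub>C d (k + l) v + vir_cocycle k l *\<^sub>C z v"
proof -
  have "d k (d l v) - d l (d k v) = act (lie_bracket (vd k) (vd l)) v"
    by (simp only: lie_module_bracket[OF module])
  also have "\<dots> = of_int (k - l) *\<^sub>C d (k + l) v + vir_cocycle k l *\<^sub>C z v"
    by (simp only: vir_relations act_left_simps) (simp add: vir_cocycle_def act_left_simps)
  finally show ?thesis by (simp only: diff_eq_eq add_ac)
qed

lemma z_commute: "z (d k v) = d k (z v)"
  using lie_module_bracket[OF module, of vz "vd k" v]
  by (simp add: vir_relations act_left_simps)

lemma invariant_subspaceI:
  assumes S: "complex_vec.subspace S" and "\<And>k v. v \<in> S \<Longrightarrow> d k v \<in> S" "\<And>v. v \<in> S \<Longrightarrow> z v \<in> S"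
  shows "lie_submodule act S"
proof -
  have "act x v \<in> S" if "v \<in> S" for x v
  proof (induction x rule: vir_induct)
    case zero
    then show ?case using S by (simp add: act_left_simps complex_vec.subspace_0)
  next
    case (basis c i)
    then show ?case
      using assms that by (cases i) (simp_all add: act_left_simps complex_vec.subspace_scale)
  next
    case (add x y)
    then show ?case using S by (simp add: act_left_simps complex_vec.subspace_add)
  qed
  then show ?thesis using S by (simp add: lie_submodule_def)
qed

text \<open>Lists need not be sorted: multiplying a monomial by a further generator
  then needs no reordering, and ordering is imposed only when uniqueness matters.\<close>

definition monomial :: "nat list \<Rightarrow> 'v \<Rightarrow> 'v" where
  "monomial js x = foldr (\<lambda>j. d (- int j)) js x"

lemma monomial_Nil [simp]: "monomial [] x = x"
  and monomial_Cons [simp]: "monomial (j # js) x = d (- int j) (monomial js x)"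
  by (simp_all add: monomial_def)

lemma linC_monomial: "linC (monomial js)"
  by (induction js) (simp_all add: linC_def act_simps)

lemma z_monomial: "z (monomial js x) = monomial js (z x)"
  by (induction js) (simp_all add: z_commute)

subsection \<open>Reordering\<close>

text \<open>The error of a transposition: \<open>[d\<^sub>-\<^sub>i, d\<^sub>-\<^sub>j]\<close> is a multiple of
  \<open>d\<^sub>-\<^sub>i\<^sub>-\<^sub>j\<close>, so it keeps the total index and loses one factor. No central term arises among
  non-positive indices.\<close>

definition shorter :: "'v \<Rightarrow> nat \<Rightarrow> nat \<Rightarrow> 'v set" where
  "shorter x n m = complex_vec.span {monomial js x | js. sum_list js = n \<and> length js < m}"

lemma subspace_shorter [simp]: "complex_vec.subspace (shorter x n m)"
  by (simp add: shorter_def)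

lemma shorterI: "sum_list js = n \<Longrightarrow> length js < m \<Longrightarrow> monomial js x \<in> shorter x n m"
  unfolding shorter_def by (rule complex_vec.span_base) blast

lemma shorter_Cons: "v \<in> shorter x n m \<Longrightarrow> d (- int j) v \<in> shorter x (j + n) (Suc m)"
  unfolding shorter_def[of x n m]
proof (rule linC_span_into[OF act_linC subspace_shorter])
  fix b assume "b \<in> {monomial js x |js. sum_list js = n \<and> length js < m}"
  then obtain js where "b = monomial js x" "sum_list js = n" "length js < m" by auto
  then show "d (- int j) b \<in> shorter x (j + n) (Suc m)"
    using shorterI[of "j # js" "j + n" "Suc m" x] by simp
qed

lemma monomial_move_to_front:
  "j \<in> set js \<Longrightarrow> monomial (j # remove1 j js) x - monomial js x \<in> shorter x (sum_list js) (length js)"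
proof (induction js)
  case (Cons i js)
  show ?case
  proof (cases "i = j")
    case True
    then show ?thesis by (simp add: complex_vec.subspace_0)
  next
    case False
    then have j: "j \<in> set js" using Cons.prems by simp
    let ?r = "remove1 j js"
    have r: "sum_list js = j + sum_list ?r" "length js = Suc (length ?r)"
      using j sum_list_map_remove1[of j js id] length_pos_if_in_set[OF j]
      by (auto simp: length_remove1)
    have c: "vir_cocycle (- int j) (- int i) = 0"
      using False by (auto simp: vir_cocycle_def)
    have "monomial (j # i # ?r) x - monomial (i # js) x
        = d (- int i) (monomial (j # ?r) x - monomial js x) + of_int (- int j - - int i) *\<^sub>C monomial ((i + j) # ?r) x"
      using d_commute[of "- int j" "- int i" "monomial ?r x"] unfolding c
      by (simp add: act_simps algebra_simps del: of_int_diff of_int_minus)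
    moreover have "d (- int i) (monomial (j # ?r) x - monomial js x) \<in> shorter x (i + sum_list js) (Suc (length js))"
      by (rule shorter_Cons[OF Cons.IH[OF j]])
    moreover have "monomial ((i + j) # ?r) x \<in> shorter x (i + sum_list js) (Suc (length js))"
      by (rule shorterI) (simp_all add: r)
    ultimately show ?thesis
      using False by (simp add: complex_vec.subspace_add complex_vec.subspace_scale del: monomial_Cons)
  qed
qed simp

lemma monomial_permute:
  "mset js = mset ks \<Longrightarrow> monomial js x - monomial ks x \<in> shorter x (sum_list js) (length js)"
proof (induction js arbitrary: ks)
  case Nil
  then show ?case by (simp add: complex_vec.subspace_0)
next
  case (Cons j js)
  from Cons.prems have j: "j \<in> set ks" by (metis list.set_intros(1) set_mset_mset)
  have ks: "sum_list ks = sum_list (j # js)" "length ks = length (j # js)"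
    using Cons.prems by (metis sum_mset_sum_list, metis size_mset)
  have "mset js = mset (remove1 j ks)" using Cons.prems by (metis add_mset_remove_trivial mset.simps(2) mset_remove1)
  from shorter_Cons[OF Cons.IH[OF this], of j]
  have "monomial (j # js) x - monomial (j # remove1 j ks) x \<in> shorter x (sum_list (j # js)) (length (j # js))"
    by (simp add: act_simps)
  from complex_vec.subspace_add[OF subspace_shorter this] monomial_move_to_front[OF j, of x]
  show ?case unfolding ks by fastforce
qed

abbreviation pbw :: "nat multiset \<Rightarrow> 'v \<Rightarrow> 'v" where
  "pbw \<mu> \<equiv> monomial (sorted_list_of_multiset \<mu>)"

text \<open>Sorting a list costs only shorter monomials, so induction on the length applies.\<close>

lemma monomial_in_span_pbw: "monomial js x \<in> complex_vec.span {pbw \<mu> x | \<mu>. True}"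
proof (induction "length js" arbitrary: js rule: less_induct)
  case less
  have "shorter x (sum_list js) (length js) \<subseteq> complex_vec.span {pbw \<mu> x | \<mu>. True}"
    unfolding shorter_def by (rule complex_vec.span_minimal) (use less in auto)
  then have "monomial js x - pbw (mset js) x \<in> complex_vec.span {pbw \<mu> x | \<mu>. True}"
    using monomial_permute[of js "sorted_list_of_multiset (mset js)" x] by auto
  moreover have "pbw (mset js) x \<in> complex_vec.span {pbw \<mu> x | \<mu>. True}"
    by (rule complex_vec.span_base) blast
  ultimately show ?case using complex_vec.span_add by fastforce
qed

text \<open>Monomials with the same exponent are collected into one, whose coefficient
  is a vector of \<open>Z\<close> rather than a number.\<close>

lemma span_pbw_expansion:
  assumes Z: "complex_vec.subspace Z"
    and "v \<in> complex_vec.span {monomial js x | js x. x \<in> Z}"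
  obtains M X where "finite M" "\<And>\<mu>. X \<mu> \<in> Z" "v = (\<Sum>\<mu>\<in>M. pbw \<mu> (X \<mu>))"
proof -
  let ?P = "\<lambda>v. \<exists>M X. finite M \<and> (\<forall>\<mu>. X \<mu> \<in> Z) \<and> v = (\<Sum>\<mu>\<in>M. pbw \<mu> (X \<mu>))"
  have "complex_vec.span {monomial js x | js x. x \<in> Z} \<subseteq> complex_vec.span {pbw \<mu> x | \<mu> x. x \<in> Z}"
  proof (rule complex_vec.span_minimal)
    show "{monomial js x | js x. x \<in> Z} \<subseteq> complex_vec.span {pbw \<mu> x | \<mu> x. x \<in> Z}"
    proof safe
      fix js x assume "x \<in> Z"
      then have "complex_vec.span {pbw \<mu> x | \<mu>. True} \<subseteq> complex_vec.span {pbw \<mu> x | \<mu> x. x \<in> Z}"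
        by (intro complex_vec.span_mono) auto
      then show "monomial js x \<in> complex_vec.span {pbw \<mu> x | \<mu> x. x \<in> Z}"
        using monomial_in_span_pbw by blast
    qed
  qed simp
  with assms(2) have "v \<in> complex_vec.span {pbw \<mu> x | \<mu> x. x \<in> Z}" by blast
  then have "?P v"
  proof (induction v rule: complex_vec.span_induct_alt)
    case base
    show ?case by (rule exI[of _ "{}"]) (use complex_vec.subspace_0[OF Z] in auto)
  next
    case (step c b v)
    then obtain \<mu> x M X where *: "b = pbw \<mu> x" "x \<in> Z" "finite M" "\<And>\<mu>. X \<mu> \<in> Z"
      "v = (\<Sum>\<mu>\<in>M. pbw \<mu> (X \<mu>))" by auto
    define X0 where "X0 \<nu> = (if \<nu> \<in> M then X \<nu> else 0)" for \<nu>
    define X1 where "X1 = X0(\<mu> := X0 \<mu> + c *\<^sub>C x)"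
    have Z1: "X1 \<nu> \<in> Z" for \<nu>
      using * Z by (auto simp: X1_def X0_def intro!: complex_vec.subspace_add
          complex_vec.subspace_scale complex_vec.subspace_0)
    have "v = (\<Sum>\<nu>\<in>insert \<mu> M. pbw \<nu> (X0 \<nu>))"
      unfolding *(5) by (rule sum.mono_neutral_cong_left)
        (use *(3) in \<open>auto simp: X0_def linC_zero[OF linC_monomial]\<close>)
    also have "\<dots> = pbw \<mu> (X0 \<mu>) + (\<Sum>\<nu>\<in>M - {\<mu>}. pbw \<nu> (X0 \<nu>))"
      using *(3) by (simp add: sum.insert_remove)
    finally have "c *\<^sub>C b + v = pbw \<mu> (X1 \<mu>) + (\<Sum>\<nu>\<in>M - {\<mu>}. pbw \<nu> (X1 \<nu>))"
      by (simp add: X1_def *(1) linC_add[OF linC_monomial] linC_scaleC[OF linC_monomial])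
    also have "\<dots> = (\<Sum>\<nu>\<in>insert \<mu> M. pbw \<nu> (X1 \<nu>))"
      using *(3) by (simp add: sum.insert_remove)
    finally show ?case using *(3) Z1 by blast
  qed
  then show thesis using that by blast
qed

subsection \<open>Submodules spanned by monomials\<close>

text \<open>Moving \<open>d\<^sub>k\<close> to the right past \<open>d\<^sub>-\<^sub>i\<close> leaves a multiple of \<open>d\<^sub>k\<^sub>-\<^sub>i\<close> and a central
  term, both acting on a shorter monomial. The submodule \<open>K\<close> makes the argument work modulo
  relations: it is \<open>0\<close> inside a simple module, and the left ideal defining \<open>L(\<psi>, \<xi>)\<close> inside the
  enveloping algebra.\<close>

lemma span_monomial_submodule:
  assumes K: "lie_submodule act K"
    and pos: "\<And>x k. x \<in> Z \<Longrightarrow> k > 0 \<Longrightarrow> d k x \<in> complex_vec.span (Z \<union> K)"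
    and cen: "\<And>x. x \<in> Z \<Longrightarrow> z x \<in> complex_vec.span (Z \<union> K)"
  shows "lie_submodule act (complex_vec.span ({monomial js x | js x. x \<in> Z} \<union> K))"
proof -
  define B where "B = {monomial js x | js x. x \<in> Z} \<union> K"
  let ?S = "complex_vec.span B"
  have K': "act y x \<in> ?S" if "x \<in> K" for x y
    using K that by (intro complex_vec.span_base) (auto simp: lie_submodule_def B_def)
  have ZK: "complex_vec.span (Z \<union> K) \<subseteq> ?S"
    by (rule complex_vec.span_mono) (auto simp: B_def intro: exI[of _ "[]"])
  have nonpos: "d (- int j) v \<in> ?S" if "v \<in> ?S" for j v
  proof (rule linC_span_into[OF act_linC complex_vec.subspace_span _ that])
    fix b assume "b \<in> B"
    then consider js x where "b = monomial js x" "x \<in> Z" | "b \<in> K" by (auto simp: B_def)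
    then show "d (- int j) b \<in> ?S"
    proof cases
      case 1
      then have "d (- int j) b = monomial (j # js) x" by simp
      then show ?thesis using 1(2) by (intro complex_vec.span_base) (auto simp: B_def simp del: monomial_Cons)
    qed (rule K')
  qed
  have z_inv: "z v \<in> ?S" if "v \<in> ?S" for v
  proof (rule linC_span_into[OF act_linC complex_vec.subspace_span _ that])
    fix b assume "b \<in> B"
    then consider js x where "b = monomial js x" "x \<in> Z" | "b \<in> K" by (auto simp: B_def)
    then show "z b \<in> ?S"
    proof cases
      case 1
      have "z (monomial js x) \<in> ?S"
        using cen[OF 1(2)] ZK by (induction js) (auto simp: z_commute intro: nonpos)
      then show ?thesis using 1 by simp
    qed (rule K')
  qed
  have mono_S: "monomial js x \<in> ?S" if "x \<in> Z" for js x
    using that by (intro complex_vec.span_base) (auto simp: B_def)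
  have mono_inv: "d k (monomial js x) \<in> ?S" if x: "x \<in> Z" for k js x
  proof (induction js arbitrary: k)
    case Nil
    show ?case
    proof (cases "k > 0")
      case True
      then show ?thesis using pos[OF x] ZK by auto
    next
      case False
      then show ?thesis using nonpos[OF mono_S[OF x, of "[]"], of "nat (- k)"] by simp
    qed
  next
    case (Cons i js)
    show ?case
      unfolding monomial_Cons d_commute[of k "- int i"]
      by (intro complex_vec.span_add complex_vec.span_scale nonpos Cons.IH z_inv mono_S x)
  qed
  have "d k v \<in> ?S" if "v \<in> ?S" for k v
  proof (rule linC_span_into[OF act_linC complex_vec.subspace_span _ that])
    fix b assume "b \<in> B"
    then show "d k b \<in> ?S" using mono_inv K' by (auto simp: B_def)
  qed
  then have "lie_submodule act ?S" by (intro invariant_subspaceI z_inv) simp_all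
  then show ?thesis by (simp add: B_def)
qed

end

section \<open>Whittaker vectors\<close>

lemma vd_in_nplus: "k > 0 \<Longrightarrow> vd k \<in> nplus"
  unfolding nplus_def by (rule complex_vec.span_base) blast

text \<open>For \<open>k \<ge> 3\<close> the element \<open>d\<^sub>k\<close> is a multiple of \<open>[d\<^sub>k\<^sub>-\<^sub>1, d\<^sub>1]\<close>, hence a commutator
  in \<open>n\<^sup>+\<close>.\<close>

lemma nplus_char_vd_zero:
  assumes "nplus_char \<psi>" "k \<ge> 3"
  shows "\<psi> (vd k) = 0"
proof -
  have "lie_bracket (vd (k - 1)) (vd 1) = of_int (k - 2) *\<^sub>C vd k"
    using assms(2) by (simp add: vir_relations)
  moreover have "\<psi> (lie_bracket (vd (k - 1)) (vd 1)) = 0"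
    using assms vd_in_nplus unfolding nplus_char_def by auto
  ultimately have "of_int (k - 2) * \<psi> (vd k) = 0"
    using assms vd_in_nplus unfolding nplus_char_def by auto
  then show ?thesis using assms(2) by (simp del: of_int_diff)
qed

lemma nplus_char_0: "nplus_char \<psi> \<Longrightarrow> \<psi> 0 = 0"
  using nplus_closed(1) unfolding nplus_char_def by (metis complex_vec.scale_zero_left mult_zero_left)

lemma nplus_char_zeroI:
  assumes "nplus_char \<psi>" "\<And>k. k > 0 \<Longrightarrow> \<psi> (vd k) = 0" "x \<in> nplus"
  shows "\<psi> x = 0"
proof -
  from assms(3) have "x \<in> nplus \<and> \<psi> x = 0"
    unfolding nplus_def
  proof (induction x rule: complex_vec.span_induct_alt)
    case base
    show ?case using nplus_char_0[OF assms(1)] by (simp add: complex_vec.span_zero)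
  next
    case (step c x y)
    then show ?case
      using assms(1,2) vd_in_nplus nplus_closed
      unfolding nplus_char_def nplus_def[symmetric] by auto
  qed
  then show ?thesis by simp
qed

locale vir_module_char = vir_module act
  for act :: "vir \<Rightarrow> 'v::complex_vector \<Rightarrow> 'v" +
  fixes \<psi> :: "vir \<Rightarrow> complex"
  assumes char: "nplus_char \<psi>"
begin

definition whittaker_vectors :: "'v set" where
  "whittaker_vectors = {v. \<forall>x\<in>nplus. act x v = \<psi> x *\<^sub>C v}"

lemma subspace_whittaker: "complex_vec.subspace whittaker_vectors"
  unfolding complex_vec.subspace_def whittaker_vectors_def
  by (auto simp: act_simps scaleC_add_right scaleC_scaleC mult.commute)

lemma whittaker_d: "x \<in> whittaker_vectors \<Longrightarrow> k > 0 \<Longrightarrow> d k x = \<psi> (vd k) *\<^sub>C x"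
  using vd_in_nplus unfolding whittaker_vectors_def by blast

lemma whittaker_vectorI:
  assumes "\<And>k. k > 0 \<Longrightarrow> d k v = \<psi> (vd k) *\<^sub>C v"
  shows "v \<in> whittaker_vectors"
proof -
  have "x \<in> nplus \<and> act x v = \<psi> x *\<^sub>C v" if "x \<in> nplus" for x
    using that unfolding nplus_def
  proof (induction x rule: complex_vec.span_induct_alt)
    case base
    show ?case using nplus_char_0[OF char] by (simp add: complex_vec.span_zero act_left_simps)
  next
    case (step c x y)
    then have "act (c *\<^sub>C x + y) v = (c * \<psi> x + \<psi> y) *\<^sub>C v"
      using assms by (auto simp: act_left_simps scaleC_add_left scaleC_scaleC)
    moreover have "\<psi> (c *\<^sub>C x + y) = c * \<psi> x + \<psi> y"
      using char step vd_in_nplus nplus_closed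
      unfolding nplus_char_def nplus_def[symmetric] by auto
    ultimately show ?case
      using step vd_in_nplus nplus_closed unfolding nplus_def[symmetric] by auto
  qed
  then show ?thesis by (simp add: whittaker_vectors_def)
qed

lemma whittaker_z: "x \<in> whittaker_vectors \<Longrightarrow> z x \<in> whittaker_vectors"
  by (rule whittaker_vectorI) (simp add: z_commute[symmetric] whittaker_d act_simps)

subsection \<open>Existence\<close>

definition shifted_d :: "int \<Rightarrow> 'v \<Rightarrow> 'v" where
  "shifted_d k v = d k v - \<psi> (vd k) *\<^sub>C v"

lemma linC_shifted_d: "linC (shifted_d k)"
  unfolding shifted_d_def by (rule linC_minus_scaleC[OF act_linC])

lemma d_Suc_commutator:
  assumes "k \<ge> 2"
  shows "d (k + 1) v = (1 / of_int (1 - k)) *\<^sub>C (shifted_d 1 (d k v) - d k (shifted_d 1 v))"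
proof -
  have "shifted_d 1 (d k v) - d k (shifted_d 1 v) = of_int (1 - k) *\<^sub>C d (k + 1) v"
    using d_commute[of 1 k v] assms
    by (simp add: shifted_d_def act_simps vir_cocycle_def add.commute)
  moreover have "of_int (1 - k) \<noteq> (0::complex)"
    using assms by (simp del: of_int_diff)
  ultimately show ?thesis by (simp add: scaleC_scaleC scaleC_one del: of_int_diff)
qed

text \<open>With \<open>T = d\<^sub>1 - \<psi>(d\<^sub>1)\<close>, the operator \<open>d\<^sub>k\<^sub>+\<^sub>r\<close> is a nonzero multiple of
  \<open>(ad T)\<^sup>r d\<^sub>k\<close>, because none of the structure constants \<open>1 - k, -k, \<dots>\<close> vanishes for \<open>k \<ge> 2\<close>; the
  power of \<open>ad T\<close> expands into the products \<open>T\<^sup>a d\<^sub>k T\<^sup>b\<close>.\<close>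

lemma d_shift_in_span:
  assumes "k \<ge> 2"
  shows "d (k + int r) v \<in>
    complex_vec.span {(shifted_d 1 ^^ a) (d k ((shifted_d 1 ^^ b) v)) | a b. a + b = r}"
proof (induction r arbitrary: v)
  case 0
  show ?case by (rule complex_vec.span_base) auto
next
  case (Suc r)
  define S where "S r v = complex_vec.span
    {(shifted_d 1 ^^ a) (d k ((shifted_d 1 ^^ b) v)) | a b. a + b = r}" for r v
  have "shifted_d 1 u \<in> S (Suc r) v" if "u \<in> S r v" for u
  proof (rule linC_span_into[OF linC_shifted_d _ _ that[unfolded S_def]])
    fix b assume "b \<in> {(shifted_d 1 ^^ a) (d k ((shifted_d 1 ^^ b) v)) | a b. a + b = r}"
    then obtain p q where "b = (shifted_d 1 ^^ p) (d k ((shifted_d 1 ^^ q) v))" "p + q = r" by auto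
    then have "shifted_d 1 b = (shifted_d 1 ^^ Suc p) (d k ((shifted_d 1 ^^ q) v))" "Suc p + q = Suc r"
      by simp_all
    then show "shifted_d 1 b \<in> S (Suc r) v"
      unfolding S_def by (intro complex_vec.span_base) blast
  qed (simp add: S_def)
  then have 1: "shifted_d 1 (d (k + int r) v) \<in> S (Suc r) v" using Suc by (simp add: S_def)
  have "S r (shifted_d 1 v) \<subseteq> S (Suc r) v"
    unfolding S_def
  proof (rule complex_vec.span_mono, safe)
    fix a b assume "r = a + b"
    show "\<exists>a' b'. (shifted_d 1 ^^ a) (d k ((shifted_d 1 ^^ b) (shifted_d 1 v)))
        = (shifted_d 1 ^^ a') (d k ((shifted_d 1 ^^ b') v)) \<and> a' + b' = Suc (a + b)"
      by (rule exI[of _ a], rule exI[of _ "Suc b"]) (simp add: funpow_swap1)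
  qed
  then have 2: "d (k + int r) (shifted_d 1 v) \<in> S (Suc r) v" using Suc by (auto simp: S_def)
  have 3: "k + int (Suc r) = (k + int r) + 1" "k + int r \<ge> 2" using assms by simp_all
  show ?case
    unfolding S_def[symmetric] 3(1) d_Suc_commutator[OF 3(2)]
    by (rule complex_vec.subspace_scale, simp add: S_def, rule complex_vec.subspace_diff[OF _ 1 2])
       (simp add: S_def)
qed

text \<open>The vectors killed by \<open>d\<^sub>k - \<psi>(d\<^sub>k)\<close> for all \<open>k > n\<close> are stable under \<open>d\<^sub>n - \<psi>(d\<^sub>n)\<close>, since
  \<open>[d\<^sub>k, d\<^sub>n]\<close> is a multiple of \<open>d\<^sub>k\<^sub>+\<^sub>n\<close>, which acts on them by \<open>\<psi>(d\<^sub>k\<^sub>+\<^sub>n) = 0\<close> because \<open>k + n \<ge> 3\<close>.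
  The last nonzero image of \<open>v\<close> under powers of this nilpotent operator is the required vector.\<close>

lemma whittaker_descent:
  assumes nil: "\<And>v k. k > 0 \<Longrightarrow> \<exists>p. (shifted_d k ^^ p) v = 0"
    and "v \<noteq> 0" "n > 0" "\<And>k. k > int n \<Longrightarrow> shifted_d k v = 0"
  shows "\<exists>u. u \<noteq> 0 \<and> (\<forall>k\<ge>int n. shifted_d k u = 0)"
proof -
  let ?T = "shifted_d (int n)"
  define p where "p = (LEAST p. (?T ^^ p) v = 0)"
  have "\<exists>p. (?T ^^ p) v = 0" using nil[of "int n"] \<open>n > 0\<close> by simp
  then have p: "(?T ^^ p) v = 0" unfolding p_def by (rule LeastI_ex)
  with \<open>v \<noteq> 0\<close> obtain q where q: "p = Suc q" by (cases p) auto
  have q': "(?T ^^ q) v \<noteq> 0" using not_less_Least[of q "\<lambda>p. (?T ^^ p) v = 0"] q p_def by simp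
  have *: "shifted_d k ((?T ^^ r) v) = 0" if "k > int n" for r k
    using that
  proof (induction r arbitrary: k)
    case 0
    then show ?case using assms(4) by simp
  next
    case (Suc r)
    define y where "y = (?T ^^ r) v"
    have y: "shifted_d k y = 0" if "k > int n" for k using Suc.IH[OF that] by (simp add: y_def)
    have "\<psi> (vd (k + int n)) = 0"
      using Suc.prems \<open>n > 0\<close> by (intro nplus_char_vd_zero[OF char]) simp
    then have "d (k + int n) y = 0" using y[of "k + int n"] Suc.prems by (simp add: shifted_d_def)
    moreover have "d k y = \<psi> (vd k) *\<^sub>C y" using y[OF Suc.prems] by (simp add: shifted_d_def)
    moreover have "vir_cocycle k (int n) = 0" using Suc.prems by (simp add: vir_cocycle_def)
    ultimately have "d k (d (int n) y) = \<psi> (vd k) *\<^sub>C d (int n) y"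
      using d_commute[of k "int n" y] by (simp add: act_simps)
    then have "shifted_d k (?T y) = 0"
      using \<open>d k y = _\<close> unfolding shifted_d_def
      by (simp add: act_simps scaleC_scaleC complex_vec.scale_right_diff_distrib mult.commute)
    then show ?case by (simp add: y_def)
  qed
  have "?T ((?T ^^ q) v) = 0" using p q by simp
  then have "shifted_d k ((?T ^^ q) v) = 0" if "k \<ge> int n" for k
    using that * by (cases "k = int n") auto
  with q' show ?thesis by blast
qed

text \<open>This is a concrete form of Engel's theorem for the operators \<open>x - \<psi>(x)\<close>: finite dimension
  is used only to bound the order of nilpotency of \<open>d\<^sub>1 - \<psi>(d\<^sub>1)\<close> uniformly, which removes all but finitely many of the operators.\<close>

lemma whittaker_vector_exists:
  assumes fin: "fin_dim (nplus_orbit act v)" and "v \<noteq> 0"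
    and nil: "\<And>v k. k > 0 \<Longrightarrow> \<exists>p. (shifted_d k ^^ p) v = 0"
  shows "\<exists>w\<in>whittaker_vectors. w \<noteq> 0"
proof -
  let ?O = "nplus_orbit act v" and ?T = "shifted_d 1"
  have v: "v \<in> ?O"
    unfolding nplus_orbit_def by (rule complex_vec.span_base, rule CollectI, rule exI[of _ "[]"]) simp
  have O_sub: "complex_vec.subspace ?O" by (simp add: nplus_orbit_def)
  have O_d: "d k u \<in> ?O" if "u \<in> ?O" "k > 0" for k u
    using that(1) unfolding nplus_orbit_def
  proof (rule linC_span_into[OF act_linC complex_vec.subspace_span, rotated])
    fix b assume "b \<in> {foldr act xs v |xs. set xs \<subseteq> nplus}"
    then obtain xs where "b = foldr act xs v" "set xs \<subseteq> nplus" by auto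
    then have "d k b = foldr act (vd k # xs) v" "set (vd k # xs) \<subseteq> nplus"
      using vd_in_nplus[OF that(2)] by simp_all
    then show "d k b \<in> complex_vec.span {foldr act xs v |xs. set xs \<subseteq> nplus}"
      by (intro complex_vec.span_base) blast
  qed
  have O_T: "(?T ^^ a) u \<in> ?O" if "u \<in> ?O" for a u
    using that O_d O_sub
    by (induction a) (simp_all add: shifted_d_def complex_vec.subspace_diff complex_vec.subspace_scale)
  have T_le: "(?T ^^ b) u = 0" if "(?T ^^ a) u = 0" "a \<le> b" for a b u
  proof -
    have "(?T ^^ (b - a + a)) u = (?T ^^ (b - a)) 0"
      unfolding funpow_add using that(1) by simp
    then show ?thesis using that(2) by (simp add: linC_zero[OF linC_funpow[OF linC_shifted_d]])
  qed
  obtain B where B: "finite B" "?O = complex_vec.span B" using fin by (auto simp: fin_dim_def)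
  obtain p where p: "\<And>b. (?T ^^ p b) b = 0" using nil[of 1] by (metis zero_less_one)
  define q where "q = Max (insert 0 (p ` B))"
  have q: "(?T ^^ q) u = 0" if "u \<in> ?O" for u
  proof -
    have "(?T ^^ q) b = 0" if "b \<in> B" for b
      using that B(1) by (intro T_le[OF p[of b]]) (auto simp: q_def)
    moreover have "complex_vec.subspace {0}" by simp
    ultimately show ?thesis
      using linC_span_into[OF linC_funpow[OF linC_shifted_d], of "{0}" B q 1 u] that B(2) by auto
  qed
  \<comment> \<open>In a product \<open>T\<^sup>a d\<^sub>k T\<^sup>b\<close> with \<open>a + b = 2q\<close>, one of the two powers is at least \<open>q\<close>.\<close>
  have big: "d (k + int (2 * q)) u = 0" if k: "k \<ge> 2" and u: "u \<in> ?O" for k u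
  proof -
    have "(?T ^^ a) (d k ((?T ^^ b) u)) = 0" if ab: "a + b = 2 * q" for a b
    proof (cases "a \<ge> q")
      case True
      have "d k ((?T ^^ b) u) \<in> ?O" using u O_T O_d k by simp
      from q[OF this] True show ?thesis by (rule T_le)
    next
      case False
      then have "(?T ^^ b) u = 0" using ab by (intro T_le[OF q[OF u]]) simp
      then show ?thesis by (simp add: act_simps linC_zero[OF linC_funpow[OF linC_shifted_d]])
    qed
    then have "{(?T ^^ a) (d k ((?T ^^ b) u)) | a b. a + b = 2 * q} \<subseteq> {0}" by auto
    from complex_vec.span_minimal[OF this] d_shift_in_span[OF k, of "2 * q" u] show ?thesis by auto
  qed
  have "\<exists>u. u \<noteq> 0 \<and> (\<forall>k>int (2 + 2 * q). shifted_d k u = 0)"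
  proof (intro exI conjI allI impI)
    fix k assume k: "k > int (2 + 2 * q)"
    then have "\<psi> (vd k) = 0" by (intro nplus_char_vd_zero[OF char]) simp
    then show "shifted_d k v = 0" using big[of "k - int (2 * q)" v] k v by (simp add: shifted_d_def)
  qed fact
  moreover have "\<exists>u. u \<noteq> 0 \<and> (\<forall>k>int 0. shifted_d k u = 0)"
    if "\<exists>u. u \<noteq> 0 \<and> (\<forall>k>int n. shifted_d k u = 0)" for n
    using that
  proof (induction n)
    case (Suc n)
    then obtain u where "u \<noteq> 0" "\<forall>k>int (Suc n). shifted_d k u = 0" by blast
    then have "\<exists>u. u \<noteq> 0 \<and> (\<forall>k\<ge>int (Suc n). shifted_d k u = 0)"
      using whittaker_descent[OF nil, of u "Suc n"] by blast
    then have "\<exists>u. u \<noteq> 0 \<and> (\<forall>k>int n. shifted_d k u = 0)" by auto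
    then show ?case by (rule Suc.IH)
  qed
  ultimately obtain u where "u \<noteq> 0" "\<forall>k>int 0. shifted_d k u = 0" by blast
  then show ?thesis
    by (intro bexI[of _ u] whittaker_vectorI) (auto simp: shifted_d_def)
qed

end

section \<open>Freeness over the Whittaker vectors\<close>

text \<open>The index \<open>s\<close> is the largest one on which \<open>\<psi>\<close> does not vanish, so that the cases
  \<open>\<psi>(d\<^sub>2) \<noteq> 0\<close> and \<open>\<psi>(d\<^sub>2) = 0 \<noteq> \<psi>(d\<^sub>1)\<close> are treated alike.\<close>

locale vir_module_char_nonzero = vir_module_char act \<psi>
  for act :: "vir \<Rightarrow> 'v::complex_vector \<Rightarrow> 'v" and \<psi> +
  fixes s :: int
  assumes s_range: "s = 1 \<or> s = 2"
    and char_s: "\<psi> (vd s) \<noteq> 0"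
    and char_above_s: "k > s \<Longrightarrow> \<psi> (vd k) = 0"
begin

text \<open>Monomials strictly below weight \<open>n\<close> and degree \<open>m\<close> in the lexicographic order, where the weight comes
  first. The indices are integers because lowering may push them below zero, where the
  space is trivial.\<close>

definition filt :: "int \<Rightarrow> int \<Rightarrow> 'v set" where
  "filt n m = complex_vec.span {monomial js x | js x. x \<in> whittaker_vectors \<and>
     (int (sum_list js) < n \<or> int (sum_list js) = n \<and> int (length js) < m)}"

lemma subspace_filt [simp]: "complex_vec.subspace (filt n m)"
  by (simp add: filt_def)

lemmas filt_closed = complex_vec.subspace_0[OF subspace_filt] complex_vec.subspace_add[OF subspace_filt]
  complex_vec.subspace_diff[OF subspace_filt] complex_vec.subspace_scale[OF subspace_filt]

lemma filtI:
  "x \<in> whittaker_vectors \<Longrightarrow>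
   int (sum_list js) < n \<or> int (sum_list js) = n \<and> int (length js) < m \<Longrightarrow> monomial js x \<in> filt n m"
  unfolding filt_def by (rule complex_vec.span_base) blast

lemma filt_mono: "n < n' \<or> n = n' \<and> m \<le> m' \<Longrightarrow> filt n m \<subseteq> filt n' m'"
  unfolding filt_def by (rule complex_vec.span_mono) (auto 4 3)

lemma filt_cons:
  assumes "v \<in> filt n m" "m + 1 \<le> m' \<or> m \<le> 0"
  shows "d (- int j) v \<in> filt (int j + n) m'"
proof (rule linC_span_into[OF act_linC subspace_filt _ assms(1)[unfolded filt_def]])
  fix b assume "b \<in> {monomial js x | js x. x \<in> whittaker_vectors \<and>
     (int (sum_list js) < n \<or> int (sum_list js) = n \<and> int (length js) < m)}"
  then obtain js x where "b = monomial js x" "x \<in> whittaker_vectors"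
    "int (sum_list js) < n \<or> int (sum_list js) = n \<and> int (length js) < m" by auto
  then show "d (- int j) b \<in> filt (int j + n) m'"
    using filtI[of x "j # js" "int j + n" m'] assms(2) by auto
qed

lemma shorter_subset_filt:
  assumes "x \<in> whittaker_vectors"
  shows "shorter x n m \<subseteq> filt (int n) (int m)"
  unfolding shorter_def
  by (rule complex_vec.span_minimal) (use assms in \<open>auto intro!: filtI\<close>)

text \<open>A generator \<open>d\<^sub>k\<close> lowers the weight by \<open>k\<close>, except for what a Whittaker vector absorbs. Commuting
  past factors \<open>d\<^sub>-\<^sub>i\<close> never raises the index, so for \<open>k < s\<close> the absorbed generator has index at most
  \<open>s - 1\<close>, and the weight drops by more than \<open>k - s\<close>.\<close>

lemma d_below_s:
  assumes x: "x \<in> whittaker_vectors"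
  shows "k < s \<Longrightarrow> d k (monomial js x) \<in> filt (int (sum_list js) - k + s) 0"
proof (induction js arbitrary: k)
  case Nil
  show ?case
  proof (cases "k > 0")
    case True
    then have "monomial [] x \<in> filt (int (sum_list []) - k + s) 0"
      using Nil by (intro filtI x) simp
    then show ?thesis using True by (simp add: whittaker_d[OF x] filt_closed)
  next
    case False
    then show ?thesis
      using filtI[OF x, of "[nat (- k)]" "- k + s" 0] s_range by auto
  qed
next
  case (Cons i js)
  let ?F = "filt (int (sum_list (i # js)) - k + s) 0"
  have 1: "d (- int i) (d k (monomial js x)) \<in> ?F"
    using filt_cons[OF Cons.IH[OF Cons.prems], of 0 i] by (simp add: algebra_simps)
  have 2: "d (k + - int i) (monomial js x) \<in> ?F"
    using Cons.IH[of "k + - int i"] Cons.prems by (simp add: algebra_simps)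
  have 3: "vir_cocycle k (- int i) *\<^sub>C z (monomial js x) \<in> ?F"
  proof (cases "k = int i")
    case True
    then show ?thesis
      using Cons.prems unfolding z_monomial by (intro filt_closed filtI whittaker_z x) simp
  qed (simp add: vir_cocycle_def filt_closed)
  show ?case
    unfolding monomial_Cons d_commute[of k "- int i"]
    by (intro filt_closed 1 2 3)
qed

definition lowering :: "nat \<Rightarrow> 'v \<Rightarrow> 'v" where
  "lowering j = shifted_d (int j + s)"

lemma lowering_eq: "lowering j v = d (int j + s) v - \<psi> (vd (int j + s)) *\<^sub>C v"
  by (simp add: lowering_def shifted_d_def)

lemma linC_lowering: "linC (lowering j)"
  unfolding lowering_def by (rule linC_shifted_d)

text \<open>The coefficient comes from \<open>[d\<^sub>j\<^sub>+\<^sub>s, d\<^sub>-\<^sub>j] = (2j + s) d\<^sub>s\<close>, where \<open>d\<^sub>s\<close> then acts by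
  \<open>\<psi>(d\<^sub>s)\<close> up to lower terms.\<close>

definition lowering_coeff :: "nat \<Rightarrow> complex" where
  "lowering_coeff j = of_int (2 * int j + s) * \<psi> (vd s)"

lemma lowering_coeff_nonzero: "lowering_coeff j \<noteq> 0"
proof -
  have "2 * int j + s \<noteq> 0" using s_range by auto
  then show ?thesis unfolding lowering_coeff_def using char_s
    by (simp del: of_int_add of_int_mult)
qed

text \<open>Up to the factor \<open>lowering_coeff j\<close> this is the partial derivative of the monomial in the variable
  \<open>d\<^sub>-\<^sub>j\<close>.\<close>

definition leading :: "nat \<Rightarrow> nat list \<Rightarrow> 'v \<Rightarrow> 'v" where
  "leading j js x = (of_nat (count (mset js) j) * lowering_coeff j) *\<^sub>C monomial (remove1 j js) x"

lemma leading_in_filt: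
  assumes "x \<in> whittaker_vectors"
  shows "leading j js x \<in> filt (int (sum_list js) - int j) (int (length js))"
proof (cases "j \<in> set js")
  case True
  have "sum_list js = j + sum_list (remove1 j js)" "length js = Suc (length (remove1 j js))"
    using True sum_list_map_remove1[of j js id] length_pos_if_in_set[OF True]
    by (auto simp: length_remove1)
  then show ?thesis unfolding leading_def by (intro filt_closed filtI assms) simp
next
  case False
  then have c: "count (mset js) j = 0" by (simp add: count_mset_0_iff)
  show ?thesis by (simp add: leading_def filt_closed c)
qed

lemma leading_cons:
  assumes "x \<in> whittaker_vectors"
  shows "leading j (i # js) x - d (- int i) (leading j js x)
      - (if i = j then lowering_coeff j *\<^sub>C monomial js x else 0)
    \<in> filt (int (sum_list (i # js)) - int j) (int (length js))"
proof (cases "i = j")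
  case False
  then show ?thesis by (simp add: leading_def act_simps filt_closed)
next
  case True
  show ?thesis
  proof (cases "j \<in> set js")
    case False
    then have c: "count (mset js) j = 0" by (simp add: count_mset_0_iff)
    show ?thesis using True by (simp add: leading_def act_simps filt_closed c)
  next
    case j: True
    let ?c = "of_nat (count (mset js) j) * lowering_coeff j"
    have "leading j (i # js) x - d (- int i) (leading j js x)
        - (if i = j then lowering_coeff j *\<^sub>C monomial js x else 0)
      = - ?c *\<^sub>C (monomial (j # remove1 j js) x - monomial js x)"
      using True by (simp add: leading_def act_simps scaleC_add_left distrib_right
          complex_vec.scale_right_diff_distrib)
    moreover have "monomial (j # remove1 j js) x - monomial js x
        \<in> filt (int (sum_list js)) (int (length js))"
      using monomial_move_to_front[OF j] shorter_subset_filt[OF assms] by blast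
    ultimately show ?thesis
      using filt_closed(4)[of "monomial (j # remove1 j js) x - monomial js x" _ _ "- ?c"] True
      by simp
  qed
qed

text \<open>Commuting \<open>d\<^sub>j\<^sub>+\<^sub>s\<close> past a factor \<open>d\<^sub>-\<^sub>i\<close> leaves \<open>d\<^sub>j\<^sub>+\<^sub>s\<^sub>-\<^sub>i\<close>. For \<open>i > j\<close> its index is below \<open>s\<close>
  and the weight drops too far to matter; for \<open>i = j\<close> it is \<open>d\<^sub>s\<close>, which produces the leading term;
  for \<open>i < j\<close> it is a lowering operator again, with \<open>\<psi>\<close>-value \<open>0\<close>, acting on a product that has already lost the factor \<open>d\<^sub>-\<^sub>i\<close>, so the
  degree drops by two.\<close>

lemma lowering_monomial:
  assumes x: "x \<in> whittaker_vectors"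
  shows "lowering j (monomial js x) - leading j js x
    \<in> filt (int (sum_list js) - int j) (int (length js) - 1)"
proof (induction js arbitrary: j)
  case Nil
  have "int j + s > 0" using s_range by auto
  then show ?case by (simp add: lowering_eq leading_def whittaker_d[OF x] filt_closed)
next
  case (Cons i js)
  let ?F = "filt (int (sum_list (i # js)) - int j) (int (length js))"
  let ?y = "monomial js x"
  have crude: "lowering j' ?y \<in> filt (int (sum_list js) - int j') (int (length js))" for j'
  proof -
    have "lowering j' ?y - leading j' js x \<in> filt (int (sum_list js) - int j') (int (length js))"
      by (rule subsetD[OF filt_mono Cons.IH]) simp
    from filt_closed(2)[OF this leading_in_filt[OF x]] show ?thesis by simp
  qed
  define r where "r = of_int (int j + s - - int i) *\<^sub>C d (int j + s + - int i) ?y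
    + vir_cocycle (int j + s) (- int i) *\<^sub>C z ?y"
  have rest: "d (- int i) (lowering j ?y - leading j js x) \<in> ?F"
    using filt_cons[OF Cons.IH[of j], of "int (length js)" i] by (simp add: algebra_simps)
  have bracket: "r - (if i = j then lowering_coeff j *\<^sub>C ?y else 0) \<in> ?F"
  proof -
    consider "i > j" | "i = j" | "i < j" by linarith
    then show ?thesis
    proof cases
      case 1
      have "d (int j + s + - int i) ?y \<in> filt (int (sum_list js) - (int j + s + - int i) + s) 0"
        using 1 by (intro d_below_s x) simp
      also have "\<dots> \<subseteq> ?F" by (rule filt_mono) simp
      finally have "d (int j + s + - int i) ?y \<in> ?F" .
      moreover have "vir_cocycle (int j + s) (- int i) *\<^sub>C z ?y \<in> ?F"
      proof (cases "int i = int j + s")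
        case True
        then show ?thesis unfolding z_monomial using s_range
          by (intro filt_closed filtI whittaker_z x) auto
      qed (simp add: vir_cocycle_def filt_closed)
      ultimately show ?thesis using 1 by (simp add: r_def filt_closed del: of_int_diff of_int_add)
    next
      case 2
      have "vir_cocycle (int j + s) (- int i) = 0"
        using 2 s_range by (auto simp: vir_cocycle_def)
      moreover have "d s ?y = \<psi> (vd s) *\<^sub>C ?y + lowering 0 ?y" by (simp add: lowering_eq)
      ultimately have "r - (if i = j then lowering_coeff j *\<^sub>C ?y else 0)
          = of_int (2 * int j + s) *\<^sub>C lowering 0 ?y"
        using 2 by (simp add: r_def lowering_coeff_def scaleC_add_right scaleC_scaleC algebra_simps
            del: of_int_add of_int_mult of_int_diff)
      then show ?thesis using crude[of 0] 2 by (simp add: filt_closed del: of_int_add of_int_mult)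
    next
      case 3
      have "vir_cocycle (int j + s) (- int i) = 0"
        using 3 s_range by (auto simp: vir_cocycle_def)
      moreover have "d (int j + s + - int i) ?y = lowering (j - i) ?y"
        using 3 char_above_s[of "int (j - i) + s"] by (simp add: lowering_eq of_nat_diff algebra_simps)
      moreover have "lowering (j - i) ?y \<in> ?F"
        using crude[of "j - i"] 3 by (simp add: of_nat_diff algebra_simps)
      ultimately show ?thesis using 3 by (simp add: r_def filt_closed del: of_int_add of_int_diff)
    qed
  qed
  have "lowering j (monomial (i # js) x) = d (- int i) (lowering j ?y) + r"
    unfolding monomial_Cons lowering_eq r_def d_commute[of "int j + s" "- int i"]
    by (simp add: act_simps)
  then have "lowering j (monomial (i # js) x) - leading j (i # js) x
    = d (- int i) (lowering j ?y - leading j js x)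
      + (r - (if i = j then lowering_coeff j *\<^sub>C ?y else 0))
      - (leading j (i # js) x - d (- int i) (leading j js x)
        - (if i = j then lowering_coeff j *\<^sub>C ?y else 0))"
    by (simp only: act_simps(3)) (simp only: algebra_simps)
  also have "\<dots> \<in> ?F"
    by (rule filt_closed(3)[OF filt_closed(2)[OF rest bracket] leading_cons[OF x]])
  finally show ?case by simp
qed

lemma lowering_filt:
  assumes "v \<in> filt n m"
  shows "lowering j v \<in> filt (n - int j) (m - 1)"
proof (rule linC_span_into[OF linC_lowering subspace_filt _ assms[unfolded filt_def]])
  fix b assume "b \<in> {monomial js x | js x. x \<in> whittaker_vectors \<and>
     (int (sum_list js) < n \<or> int (sum_list js) = n \<and> int (length js) < m)}"
  then obtain js x where b: "b = monomial js x" "x \<in> whittaker_vectors"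
    "int (sum_list js) < n \<or> int (sum_list js) = n \<and> int (length js) < m" by auto
  have "filt (int (sum_list js) - int j) (int (length js)) \<subseteq> filt (n - int j) (m - 1)"
    by (rule filt_mono) (use b(3) in auto)
  moreover have "filt (int (sum_list js) - int j) (int (length js) - 1) \<subseteq> filt (n - int j) (m - 1)"
    by (rule filt_mono) (use b(3) in auto)
  ultimately have "(lowering j b - leading j js x) + leading j js x \<in> filt (n - int j) (m - 1)"
    using lowering_monomial[OF b(2), of j js] leading_in_filt[OF b(2), of j js] b(1)
    by (intro filt_closed(2)) blast+
  then show "lowering j b \<in> filt (n - int j) (m - 1)" by simp
qed

text \<open>Applying the \<open>j\<close>-th lowering operator differentiates the leading part, and every exponent
  containing \<open>j\<close> survives with a nonzero factor. By induction on the degree all coefficients of exponents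
  that contain \<open>j\<close> vanish, and in positive degree every exponent contains some \<open>j\<close>.\<close>

lemma pbw_independent_leading:
  assumes "finite M" "\<And>\<mu>. \<mu> \<in> M \<Longrightarrow> sum_mset \<mu> = n \<and> size \<mu> = m"
    and "\<And>\<mu>. \<mu> \<in> M \<Longrightarrow> X \<mu> \<in> whittaker_vectors"
    and "(\<Sum>\<mu>\<in>M. pbw \<mu> (X \<mu>)) \<in> filt (int n) (int m)"
    and "\<mu> \<in> M"
  shows "X \<mu> = 0"
  using assms
proof (induction m arbitrary: n M X \<mu>)
  case 0
  then have empty: "\<nu> = {#}" if "\<nu> \<in> M" for \<nu> using that by simp
  have "\<mu> = {#}" by (rule empty[OF 0(5)])
  moreover have "M = {{#}}" using empty 0(5) \<open>\<mu> = {#}\<close> by blast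
  moreover have "n = 0" using 0(2)[OF 0(5)] \<open>\<mu> = {#}\<close> by simp
  moreover have "filt 0 0 = {0}"
  proof -
    have "{monomial js x | js x. x \<in> whittaker_vectors \<and>
     (int (sum_list js) < 0 \<or> int (sum_list js) = 0 \<and> int (length js) < 0)} = {}" by auto
    then show ?thesis unfolding filt_def by (simp only: complex_vec.span_empty)
  qed
  ultimately show ?case using 0(4) by simp
next
  case (Suc m)
  then have "size \<mu> = Suc m" by blast
  then obtain j \<nu> where j: "\<mu> = add_mset j \<nu>" by (metis size_eq_Suc_imp_eq_union)
  have jn: "j \<le> n" using Suc.prems(2)[OF Suc.prems(5)] j by simp
  \<comment> \<open>Exponents without \<open>j\<close> are differentiated to zero; the others are re-indexed by removing one \<open>j\<close>.\<close>
  define M' where "M' = {\<mu> \<in> M. j \<in># \<mu>}"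
  define N where "N = (\<lambda>\<mu>. \<mu> - {#j#}) ` M'"
  define Y where "Y \<nu> = (of_nat (Suc (count \<nu> j)) * lowering_coeff j) *\<^sub>C X (add_mset j \<nu>)" for \<nu>
  let ?l = "sorted_list_of_multiset"
  have len: "sum_list (?l \<mu>) = n" "length (?l \<mu>) = Suc m" if "\<mu> \<in> M" for \<mu>
    using Suc.prems(2)[OF that] by (metis mset_sorted_list_of_multiset sum_mset_sum_list,
      metis mset_sorted_list_of_multiset size_mset)
  have rem: "remove1 j (?l \<mu>) = ?l (\<mu> - {#j#})" for \<mu>
  proof -
    have "?l (\<mu> - {#j#}) = sort (remove1 j (?l \<mu>))"
      by (metis mset_remove1 mset_sorted_list_of_multiset sorted_list_of_multiset_mset)
    then show ?thesis by (simp add: sorted_remove1 sorted_sort_id)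
  qed
  have "lowering j (\<Sum>\<mu>\<in>M. pbw \<mu> (X \<mu>)) \<in> filt (int n - int j) (int (Suc m) - 1)"
    by (rule lowering_filt[OF Suc.prems(4)])
  moreover have "(\<Sum>\<mu>\<in>M. lowering j (pbw \<mu> (X \<mu>)) - leading j (?l \<mu>) (X \<mu>))
      \<in> filt (int n - int j) (int (Suc m) - 1)"
  proof (rule complex_vec.subspace_sum[OF subspace_filt])
    fix \<mu> assume "\<mu> \<in> M"
    from lowering_monomial[OF Suc.prems(3)[OF this], of j "?l \<mu>"] len[OF this]
    show "lowering j (pbw \<mu> (X \<mu>)) - leading j (?l \<mu>) (X \<mu>) \<in> filt (int n - int j) (int (Suc m) - 1)"
      by simp
  qed
  ultimately have "lowering j (\<Sum>\<mu>\<in>M. pbw \<mu> (X \<mu>))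
      - (\<Sum>\<mu>\<in>M. lowering j (pbw \<mu> (X \<mu>)) - leading j (?l \<mu>) (X \<mu>))
      \<in> filt (int n - int j) (int (Suc m) - 1)"
    by (rule filt_closed(3))
  then have "(\<Sum>\<mu>\<in>M. leading j (?l \<mu>) (X \<mu>)) \<in> filt (int (n - j)) (int m)"
    using jn by (simp add: linC_sum[OF linC_lowering] sum_subtractf of_nat_diff)
  also have "(\<Sum>\<mu>\<in>M. leading j (?l \<mu>) (X \<mu>)) = (\<Sum>\<mu>\<in>M'. leading j (?l \<mu>) (X \<mu>))"
    unfolding M'_def
    by (rule sum.mono_neutral_right) (use Suc.prems(1) in \<open>auto simp: leading_def not_in_iff\<close>)
  also have "\<dots> = (\<Sum>\<mu>\<in>M'. pbw (\<mu> - {#j#}) (Y (\<mu> - {#j#})))"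
  proof (rule sum.cong[OF refl])
    fix \<mu> assume "\<mu> \<in> M'"
    then obtain \<nu> where "\<mu> = add_mset j \<nu>" unfolding M'_def by (auto dest: multi_member_split)
    then show "leading j (?l \<mu>) (X \<mu>) = pbw (\<mu> - {#j#}) (Y (\<mu> - {#j#}))"
      by (simp add: leading_def rem Y_def linC_scaleC[OF linC_monomial])
  qed
  also have "\<dots> = (\<Sum>\<nu>\<in>N. pbw \<nu> (Y \<nu>))"
    unfolding N_def
    by (subst sum.reindex) (auto simp: inj_on_def M'_def dest!: multi_member_split)
  finally have S: "(\<Sum>\<nu>\<in>N. pbw \<nu> (Y \<nu>)) \<in> filt (int (n - j)) (int m)" .
  have N: "\<nu> \<in> N \<longleftrightarrow> add_mset j \<nu> \<in> M" for \<nu>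
  proof
    assume "\<nu> \<in> N"
    then show "add_mset j \<nu> \<in> M" by (auto simp: N_def M'_def dest!: multi_member_split)
  next
    assume "add_mset j \<nu> \<in> M"
    then show "\<nu> \<in> N" unfolding N_def M'_def by (intro image_eqI[of _ _ "add_mset j \<nu>"]) auto
  qed
  have "Y \<nu> = 0"
  proof (rule Suc.IH[OF _ _ _ S])
    show "finite N" using Suc.prems(1) by (simp add: N_def M'_def)
    show "sum_mset \<nu> = n - j \<and> size \<nu> = m" if "\<nu> \<in> N" for \<nu>
      using Suc.prems(2)[OF that[unfolded N]] by auto
    show "Y \<nu> \<in> whittaker_vectors" if "\<nu> \<in> N" for \<nu>
      unfolding Y_def
      using Suc.prems(3)[OF that[unfolded N]] by (rule complex_vec.subspace_scale[OF subspace_whittaker])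
    show "\<nu> \<in> N" using Suc.prems(5) j by (simp add: N)
  qed
  then show ?case
    using lowering_coeff_nonzero[of j] j of_nat_neq_0[of "count \<nu> j", where 'a = complex]
    by (simp add: Y_def del: of_nat_Suc)
qed

text \<open>The terms of maximal weight and, among those, of maximal degree cannot be
  cancelled by the others.\<close>

lemma pbw_independent:
  assumes "finite M" "\<And>\<mu>. \<mu> \<in> M \<Longrightarrow> X \<mu> \<in> whittaker_vectors"
    and sum0: "(\<Sum>\<mu>\<in>M. pbw \<mu> (X \<mu>)) = 0"
    and "\<mu> \<in> M"
  shows "X \<mu> = 0"
proof (rule ccontr)
  assume "X \<mu> \<noteq> 0"
  define M1 where "M1 = {\<mu> \<in> M. X \<mu> \<noteq> 0}"
  have M1: "finite M1" "M1 \<noteq> {}" using assms(1,4) \<open>X \<mu> \<noteq> 0\<close> by (auto simp: M1_def)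
  define n where "n = Max (sum_mset ` M1)"
  define M2 where "M2 = {\<mu> \<in> M1. sum_mset \<mu> = n}"
  have n: "sum_mset \<mu> \<le> n" if "\<mu> \<in> M1" for \<mu>
    using M1 that by (simp add: n_def)
  have "n \<in> sum_mset ` M1" unfolding n_def using M1 by (intro Max_in) auto
  then have M2: "finite M2" "M2 \<noteq> {}" using M1(1) by (auto simp: M2_def)
  define m where "m = Max (size ` M2)"
  have m: "size \<mu> \<le> m" if "\<mu> \<in> M2" for \<mu>
    using M2 that by (simp add: m_def)
  define M3 where "M3 = {\<mu> \<in> M2. size \<mu> = m}"
  have "m \<in> size ` M2" unfolding m_def using M2 by (intro Max_in) auto
  then obtain \<nu> where \<nu>: "\<nu> \<in> M3" by (auto simp: M3_def)
  have sub: "M3 \<subseteq> M1" by (auto simp: M3_def M2_def)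
  have "(\<Sum>\<mu>\<in>M1. pbw \<mu> (X \<mu>)) = (\<Sum>\<mu>\<in>M. pbw \<mu> (X \<mu>))"
    by (rule sum.mono_neutral_left) (auto simp: M1_def linC_zero[OF linC_monomial] assms(1))
  then have "(\<Sum>\<mu>\<in>M1. pbw \<mu> (X \<mu>)) = 0" by (simp only: sum0)
  then have "(\<Sum>\<mu>\<in>M3. pbw \<mu> (X \<mu>)) = 0 - (\<Sum>\<mu>\<in>M1 - M3. pbw \<mu> (X \<mu>))"
    unfolding sum.subset_diff[OF sub M1(1), of "\<lambda>\<mu>. pbw \<mu> (X \<mu>)"]
    by (simp add: eq_neg_iff_add_eq_0 add.commute)
  also have "\<dots> \<in> filt (int n) (int m)"
  proof (intro filt_closed complex_vec.subspace_sum[OF subspace_filt] filtI)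
    fix \<mu> assume \<mu>: "\<mu> \<in> M1 - M3"
    then show "X \<mu> \<in> whittaker_vectors" using assms(2) by (auto simp: M1_def)
    have "sum_list (sorted_list_of_multiset \<mu>) = sum_mset \<mu>"
      by (metis mset_sorted_list_of_multiset sum_mset_sum_list)
    moreover have "length (sorted_list_of_multiset \<mu>) = size \<mu>"
      by (metis mset_sorted_list_of_multiset size_mset)
    moreover have "sum_mset \<mu> < n \<or> sum_mset \<mu> = n \<and> size \<mu> < m"
      using \<mu> n[of \<mu>] m[of \<mu>] by (fastforce simp: M2_def M3_def)
    ultimately show "int (sum_list (sorted_list_of_multiset \<mu>)) < int n \<or>
        int (sum_list (sorted_list_of_multiset \<mu>)) = int n \<and>
        int (length (sorted_list_of_multiset \<mu>)) < int m" by (simp only: of_nat_less_iff of_nat_eq_iff)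
  qed
  finally have S: "(\<Sum>\<mu>\<in>M3. pbw \<mu> (X \<mu>)) \<in> filt (int n) (int m)" .
  have "X \<nu> = 0"
  proof (rule pbw_independent_leading[OF _ _ _ S \<nu>])
    show "finite M3" using sub M1(1) by (rule finite_subset)
    show "sum_mset \<mu> = n \<and> size \<mu> = m" if "\<mu> \<in> M3" for \<mu>
      using that by (simp add: M3_def M2_def)
    show "X \<mu> \<in> whittaker_vectors" if "\<mu> \<in> M3" for \<mu>
      using that sub assms(2) by (auto simp: M1_def)
  qed
  then show False using \<nu> sub by (auto simp: M1_def)
qed

end

section \<open>The centre acts by a scalar\<close>

context vir_module
begin

definition z_poly :: "complex poly \<Rightarrow> 'v \<Rightarrow> 'v" where
  "z_poly p v = fold_coeffs (\<lambda>a u. a *\<^sub>C v + z u) p 0"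

lemma z_poly_0 [simp]: "z_poly 0 v = 0"
  by (simp add: z_poly_def)

lemma z_poly_pCons [simp]: "z_poly (pCons a p) v = a *\<^sub>C v + z (z_poly p v)"
  by (cases "p = 0"; cases "a = 0") (simp_all add: z_poly_def act_simps)

lemma z_poly_add: "z_poly (p + q) v = z_poly p v + z_poly q v"
  by (induction p q rule: poly_induct2) (simp_all add: scaleC_add_left act_simps)

lemma z_poly_smult: "z_poly (smult c p) v = c *\<^sub>C z_poly p v"
  by (induction p) (simp_all add: scaleC_add_right scaleC_scaleC act_simps)

lemma z_poly_mult: "z_poly (p * q) v = z_poly p (z_poly q v)"
  by (induction p) (simp_all add: z_poly_add z_poly_smult)

lemma z_poly_z: "z_poly p (z v) = z (z_poly p v)"
  by (induction p) (simp_all add: act_simps)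

text \<open>Split off one linear factor of the annihilating polynomial after another, until one of them kills a nonzero vector.\<close>

lemma z_eigenvector_of_annihilator:
  assumes "q \<noteq> 0" "z_poly q w = 0" "w \<noteq> 0"
  shows "\<exists>y \<xi>. y \<noteq> 0 \<and> z y = \<xi> *\<^sub>C y"
  using assms
proof (induction "degree q" arbitrary: q)
  case 0
  then obtain c where "q = [:c:]" by (metis degree_0_id)
  then have "c \<noteq> 0" "c *\<^sub>C w = 0" using 0 by (simp_all add: act_simps)
  then show ?case using \<open>w \<noteq> 0\<close> by simp
next
  case (Suc n)
  then obtain r where "poly q r = 0"
    using fundamental_theorem_of_algebra[of q] constant_degree[of q] by auto
  then obtain q' where q: "q = [:- r, 1:] * q'" unfolding poly_eq_0_iff_dvd by (elim dvdE)
  have "q' \<noteq> 0" using Suc.prems(1) q by auto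
  have "z_poly [:- r, 1:] (z_poly q' w) = 0"
    using Suc.prems(2) unfolding q z_poly_mult .
  then have eig: "z (z_poly q' w) = r *\<^sub>C z_poly q' w" by (simp add: act_simps scaleC_one)
  show ?case
  proof (cases "z_poly q' w = 0")
    case True
    have "n = degree q'" using Suc.hyps(2) \<open>q' \<noteq> 0\<close> unfolding q by (subst (asm) degree_mult_eq) auto
    then show ?thesis using Suc.hyps(1) \<open>q' \<noteq> 0\<close> True Suc.prems(3) by blast
  qed (use eig in blast)
qed

end

context vir_module_char_nonzero
begin

lemma whittaker_z_poly: "x \<in> whittaker_vectors \<Longrightarrow> z_poly p x \<in> whittaker_vectors"
  by (induction p) (simp_all add: complex_vec.subspace_0[OF subspace_whittaker]
      complex_vec.subspace_add[OF subspace_whittaker]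
      complex_vec.subspace_scale[OF subspace_whittaker] whittaker_z)

text \<open>The expansion of \<open>w\<close> in monomials is unique, and \<open>w\<close> times the empty monomial is one expansion.
  Hence its coefficient at the empty monomial, which lies in \<open>Z\<close>, is \<open>w\<close>.\<close>

lemma whittaker_in_span_monomial:
  assumes Z: "complex_vec.subspace Z" "Z \<subseteq> whittaker_vectors"
    and w: "w \<in> whittaker_vectors" "w \<in> complex_vec.span {monomial js x | js x. x \<in> Z}"
  shows "w \<in> Z"
proof -
  obtain M X where M: "finite M" "\<And>\<mu>. X \<mu> \<in> Z" "w = (\<Sum>\<mu>\<in>M. pbw \<mu> (X \<mu>))"
    using span_pbw_expansion[OF Z(1) w(2)] by blast
  define X0 where "X0 \<mu> = (if \<mu> \<in> M then X \<mu> else 0)" for \<mu>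
  define Y where "Y = X0({#} := X0 {#} - w)"
  have X0: "X0 \<mu> \<in> Z" for \<mu> using M(2) Z(1) by (simp add: X0_def complex_vec.subspace_0)
  have "w = (\<Sum>\<mu>\<in>insert {#} M. pbw \<mu> (X0 \<mu>))"
    unfolding M(3) by (rule sum.mono_neutral_cong_left)
      (use M(1) in \<open>auto simp: X0_def linC_zero[OF linC_monomial]\<close>)
  also have "\<dots> = X0 {#} + (\<Sum>\<mu>\<in>M - {{#}}. pbw \<mu> (X0 \<mu>))"
    using M(1) by (simp add: sum.insert_remove)
  finally have "(\<Sum>\<mu>\<in>insert {#} M. pbw \<mu> (Y \<mu>)) = 0"
    using M(1) by (simp add: sum.insert_remove Y_def algebra_simps)
  moreover have "Y \<mu> \<in> whittaker_vectors" for \<mu>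
    using X0 Z(2) w(1) complex_vec.subspace_diff[OF subspace_whittaker]
    by (auto simp: Y_def)
  ultimately have "Y {#} = 0" using M(1) by (intro pbw_independent[of "insert {#} M" Y]) auto
  then have "w = X0 {#}" by (simp add: Y_def)
  then show ?thesis using X0 by simp
qed

text \<open>The submodule generated by \<open>C[z] z w\<close> is zero or everything. Both cases make \<open>z\<close> algebraic
  on \<open>w\<close>: either \<open>z w = 0\<close>, or \<open>w = p(z) z w\<close> for some polynomial \<open>p\<close>.\<close>

lemma center_acts_by_scalar:
  assumes simple: "\<And>S. lie_submodule act S \<Longrightarrow> S = {0} \<or> S = UNIV"
    and w: "w \<in> whittaker_vectors" "w \<noteq> 0"
  shows "\<exists>\<xi>. \<forall>v. z v = \<xi> *\<^sub>C v"
proof -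
  define Z where "Z = range (\<lambda>p. z_poly p (z w))"
  have Z: "complex_vec.subspace Z"
    unfolding complex_vec.subspace_def
  proof safe
    show "0 \<in> Z" unfolding Z_def by (rule image_eqI[of _ _ 0]) simp_all
    show "x + y \<in> Z" if "x \<in> Z" "y \<in> Z" for x y
      using that unfolding Z_def by (auto simp flip: z_poly_add)
    show "c *\<^sub>C x \<in> Z" if "x \<in> Z" for c x
      using that unfolding Z_def by (auto simp flip: z_poly_smult)
  qed
  have Z_wh: "Z \<subseteq> whittaker_vectors"
    using w(1) by (auto simp: Z_def intro!: whittaker_z_poly whittaker_z)
  have Z_z: "z x \<in> Z" if "x \<in> Z" for x
  proof -
    from that obtain p where "x = z_poly p (z w)" by (auto simp: Z_def)
    then have "z x = z_poly (pCons 0 p) (z w)" by simp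
    then show ?thesis unfolding Z_def by blast
  qed
  define S where "S = complex_vec.span {monomial js x | js x. x \<in> Z}"
  have "lie_submodule act (complex_vec.span ({monomial js x | js x. x \<in> Z} \<union> {0}))"
  proof (rule span_monomial_submodule)
    show "lie_submodule act {0}" by (simp add: lie_submodule_def act_simps)
    show "z x \<in> complex_vec.span (Z \<union> {0})" if "x \<in> Z" for x
      using Z_z[OF that] by (intro complex_vec.span_base) simp
    show "d k x \<in> complex_vec.span (Z \<union> {0})" if "x \<in> Z" "k > 0" for x k
    proof -
      have "d k x = \<psi> (vd k) *\<^sub>C x" using that Z_wh by (intro whittaker_d) auto
      then show ?thesis using that(1) by (auto intro: complex_vec.span_scale complex_vec.span_base)
    qed
  qed
  then have "lie_submodule act S" by (simp add: S_def complex_vec.span_insert_0)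
  then consider "S = {0}" | "S = UNIV" using simple by blast
  then have "\<exists>q. q \<noteq> 0 \<and> z_poly q w = 0"
  proof cases
    case 1
    have "z_poly [:1:] (z w) \<in> Z" unfolding Z_def by blast
    then have "z w \<in> Z" by (simp add: act_simps scaleC_one)
    then have "monomial [] (z w) \<in> S"
      unfolding S_def by (intro complex_vec.span_base) blast
    then have "z_poly [:0, 1:] w = 0" using 1 by (simp add: act_simps scaleC_one)
    then show ?thesis by (intro exI[of _ "[:0, 1:]"]) simp
  next
    case 2
    have "w \<in> Z" by (rule whittaker_in_span_monomial[OF Z Z_wh w(1)]) (use 2 in \<open>simp add: S_def\<close>)
    then obtain p where p: "w = z_poly p (z w)" by (auto simp: Z_def)
    have "z_poly (pCons (- 1) p) w = 0" using p by (simp add: z_poly_z scaleC_one)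
    then show ?thesis by (intro exI[of _ "pCons (- 1) p"]) simp
  qed
  then obtain y \<xi> where y: "y \<noteq> 0" "z y = \<xi> *\<^sub>C y" using z_eigenvector_of_annihilator w(2) by blast
  let ?E = "{v. z v = \<xi> *\<^sub>C v}"
  have "lie_submodule act ?E"
    by (rule invariant_subspaceI)
      (auto simp: complex_vec.subspace_def act_simps scaleC_add_right scaleC_scaleC z_commute mult.commute)
  then have "?E = UNIV" using simple y by blast
  then show ?thesis by blast
qed

end

section \<open>The induced module as a quotient of the enveloping algebra\<close>

definition frag_eval :: "('p \<Rightarrow> 'v::complex_vector) \<Rightarrow> ('p \<Rightarrow>\<^sub>0 int) \<Rightarrow> 'v" where
  "frag_eval h a = (\<Sum>k\<in>Poly_Mapping.keys a. of_int (Poly_Mapping.lookup a k) *\<^sub>C h k)"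

lemma frag_eval_superset:
  assumes "finite K" "Poly_Mapping.keys a \<subseteq> K"
  shows "frag_eval h a = (\<Sum>k\<in>K. of_int (Poly_Mapping.lookup a k) *\<^sub>C h k)"
  unfolding frag_eval_def
  by (rule sum.mono_neutral_left) (use assms in \<open>auto simp: in_keys_iff\<close>)

lemma frag_eval_zero [simp]: "frag_eval h 0 = 0"
  by (simp add: frag_eval_def)

lemma frag_eval_of [simp]: "frag_eval h (frag_of p) = h p"
  by (simp add: frag_eval_def scaleC_one)

lemma frag_eval_diff: "frag_eval h (a - b) = frag_eval h a - frag_eval h b"
proof -
  let ?K = "Poly_Mapping.keys a \<union> Poly_Mapping.keys b"
  have "frag_eval h r = (\<Sum>k\<in>?K. of_int (Poly_Mapping.lookup r k) *\<^sub>C h k)"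
    if "r = a \<or> r = b \<or> r = a - b" for r
    by (rule frag_eval_superset) (use that Poly_Mapping.keys_diff[of a b] in auto)
  then show ?thesis
    by (simp add: lookup_minus complex_vec.scale_left_diff_distrib sum_subtractf)
qed

definition induced_kernel :: "(vir \<Rightarrow> complex) \<Rightarrow> complex \<Rightarrow> (vir uea \<times> complex \<Rightarrow>\<^sub>0 int) set" where
  "induced_kernel \<psi> \<xi> =
     tensor_kernel (\<lambda>u r. u * uea_incl r) (\<lambda>r c. uea_lift (nz_char \<psi> \<xi>) r * c)"

lemma whittaker_rel_iff: "(a, b) \<in> whittaker_rel \<psi> \<xi> \<longleftrightarrow> a - b \<in> induced_kernel \<psi> \<xi>"
  by (simp add: whittaker_rel_def tensor_rel_def induced_kernel_def)

lemma induced_kernel_closed: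
  "0 \<in> induced_kernel \<psi> \<xi>"
  "a \<in> induced_kernel \<psi> \<xi> \<Longrightarrow> b \<in> induced_kernel \<psi> \<xi> \<Longrightarrow> a + b \<in> induced_kernel \<psi> \<xi>"
  "a \<in> induced_kernel \<psi> \<xi> \<Longrightarrow> b \<in> induced_kernel \<psi> \<xi> \<Longrightarrow> a - b \<in> induced_kernel \<psi> \<xi>"
  "a \<in> induced_kernel \<psi> \<xi> \<Longrightarrow> - a \<in> induced_kernel \<psi> \<xi>"
  "a \<in> induced_kernel \<psi> \<xi> \<Longrightarrow> left_mult u a \<in> induced_kernel \<psi> \<xi>"
  using whittaker_rel_left_mult[of a 0 \<psi> \<xi> u]
  unfolding induced_kernel_def whittaker_rel_iff tensor_kernel_def
  by (simp_all add: group_closure_add group_closure.diff left_mult_def)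

lemma induced_kernel_gens:
  "frag_of (u + u', c) - frag_of (u, c) - frag_of (u', c) \<in> induced_kernel \<psi> \<xi>"
  "frag_of (u * uea_incl r, c) - frag_of (u, uea_lift (nz_char \<psi> \<xi>) r * c) \<in> induced_kernel \<psi> \<xi>"
  unfolding induced_kernel_def tensor_kernel_def by (rule group_closure.base, blast)+

lemma left_mult_of: "left_mult u (frag_of (v, c)) = frag_of (u * v, c)"
  by (simp add: left_mult_def)

context
  fixes \<psi> :: "vir \<Rightarrow> complex" and \<xi> :: complex
  assumes char: "nplus_char \<psi>"
begin

lemma induced_kernel_scalar: "frag_of (u, c) - frag_of (c *\<^sub>C u, 1) \<in> induced_kernel \<psi> \<xi>"
proof -
  have "frag_of (u * uea_incl (c *\<^sub>C 1), 1) - frag_of (u, uea_lift (nz_char \<psi> \<xi>) (c *\<^sub>C 1) * 1)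
      \<in> induced_kernel \<psi> \<xi>" by (rule induced_kernel_gens)
  then have "frag_of (c *\<^sub>C u, 1) - frag_of (u, c) \<in> induced_kernel \<psi> \<xi>"
    by (simp add: uea_incl_def uea_lift_simps[OF lie_hom_nz_incl] mult_scaleC_right
        uea_lift_simps[OF lie_hom_nz_char[OF char, of \<xi>]] scaleC_complex_def)
  from induced_kernel_closed(4)[OF this] show ?thesis by simp
qed

lemma induced_kernel_diff:
  "frag_of (u, 1) - frag_of (u', 1) - frag_of (u - u', 1) \<in> induced_kernel \<psi> \<xi>"
  using induced_kernel_gens(1)[of "u - u'" u' 1 \<psi> \<xi>] by (simp add: algebra_simps)

text \<open>Scalars can be moved across the tensor sign, so \<open>1 \<otimes> 1\<close> generates.\<close>

lemma induced_module_element: "\<exists>u. (a, frag_of (u, 1)) \<in> whittaker_rel \<psi> \<xi>"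
  unfolding whittaker_rel_iff
proof (induction a rule: frag_induction[OF subset_UNIV])
  case 1
  show ?case
    using induced_kernel_gens(1)[of 0 0 1 \<psi> \<xi>] by (intro exI[of _ 0]) simp
next
  case (2 p)
  show ?case using induced_kernel_scalar by (cases p) blast
next
  case (3 a b)
  then obtain u v where "a - frag_of (u, 1) \<in> induced_kernel \<psi> \<xi>"
    "b - frag_of (v, 1) \<in> induced_kernel \<psi> \<xi>" by blast
  from induced_kernel_closed(2)[OF induced_kernel_closed(3)[OF this] induced_kernel_diff[of u v]]
  show ?case by (intro exI[of _ "u - v"]) (simp add: algebra_simps)
qed

text \<open>The annihilator of \<open>1 \<otimes> 1\<close>, a left ideal of \<open>U(g)\<close>.\<close>

definition char_ideal :: "vir uea set" where
  "char_ideal = {u. frag_of (u, 1) \<in> induced_kernel \<psi> \<xi>}"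

lemma char_ideal_diff:
  "u - u' \<in> char_ideal \<longleftrightarrow> (frag_of (u, 1), frag_of (u', 1)) \<in> whittaker_rel \<psi> \<xi>"
  unfolding char_ideal_def whittaker_rel_iff
  using induced_kernel_closed(2)[OF induced_kernel_diff[of u u'], of "frag_of (u - u', 1)"]
    induced_kernel_closed(3)[OF _ induced_kernel_diff[of u u'], of "frag_of (u, 1) - frag_of (u', 1)"]
  by auto

lemma char_ideal_left_mult: "u \<in> char_ideal \<Longrightarrow> v * u \<in> char_ideal"
  using induced_kernel_closed(5) by (fastforce simp: char_ideal_def simp flip: left_mult_of)

lemma char_ideal_submodule: "lie_submodule (\<lambda>x u. uea_of x * u) char_ideal"
  unfolding lie_submodule_def complex_vec.subspace_def
proof (intro conjI allI ballI)
  show 0: "0 \<in> char_ideal"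
    using induced_kernel_closed(4)[OF induced_kernel_gens(1)[of 0 0 1 \<psi> \<xi>]]
    by (simp add: char_ideal_def)
  show "u + v \<in> char_ideal" if "u \<in> char_ideal" "v \<in> char_ideal" for u v
  proof -
    have "frag_of (u + v, 1) - frag_of (u, 1) - frag_of (v, 1) + frag_of (u, 1) + frag_of (v, 1)
        \<in> induced_kernel \<psi> \<xi>"
      using that by (intro induced_kernel_closed(2) induced_kernel_gens) (simp_all add: char_ideal_def)
    then show ?thesis by (simp add: char_ideal_def)
  qed
  show "c *\<^sub>C u \<in> char_ideal" if "u \<in> char_ideal" for c u
    using char_ideal_left_mult[OF that, of "c *\<^sub>C 1"] by (simp add: mult_scaleC_left)
  show "uea_of x * u \<in> char_ideal" if "u \<in> char_ideal" for x u
    by (rule char_ideal_left_mult[OF that])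
qed

lemma char_ideal_gen: "uea_of (nz_incl y) - nz_char \<psi> \<xi> y *\<^sub>C 1 \<in> char_ideal"
  unfolding char_ideal_diff whittaker_rel_iff
  using induced_kernel_closed(2)[OF induced_kernel_gens(2)[of 1 "uea_of y" 1 \<psi> \<xi>]
    induced_kernel_scalar[of 1 "nz_char \<psi> \<xi> y"]]
  by (simp add: uea_incl_def uea_lift_simps[OF lie_hom_nz_incl]
      uea_lift_simps[OF lie_hom_nz_char[OF char, of \<xi>]])

lemma char_ideal_vd: "k > 0 \<Longrightarrow> uea_of (vd k) - \<psi> (vd k) *\<^sub>C 1 \<in> char_ideal"
  using char_ideal_gen[of "Abs_nz (vd k)"] nz_char_eq[of "vd k" "Abs_nz (vd k)" 0 \<psi> \<xi>]
  by (simp add: Abs_nz_inverse nplus_in_nplus_z vd_in_nplus)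

lemma char_ideal_vz: "uea_of vz - \<xi> *\<^sub>C 1 \<in> char_ideal"
proof -
  have "\<psi> 0 = 0" by (rule nplus_char_0[OF char])
  then show ?thesis
    using char_ideal_gen[of "Abs_nz vz"] nz_char_eq[OF nplus_closed(1), of "Abs_nz vz" 1 \<psi> \<xi>]
    by (simp add: Abs_nz_inverse vz_in_nplus_z scaleC_one)
qed

interpretation U: vir_module "\<lambda>x u. uea_of x * u"
  by unfold_locales (rule lie_module_uea)

text \<open>Modulo the annihilator of \<open>1 \<otimes> 1\<close> the positive generators and \<open>z\<close> act on \<open>1\<close> by scalars, so
  the monomials in non-positive generators span. This is the elementary half of the
  Poincare-Birkhoff-Witt theorem.\<close>

lemma uea_pbw_expansion:
  obtains M c k where "finite M" "k \<in> char_ideal" "u = (\<Sum>\<mu>\<in>M. U.pbw \<mu> (c \<mu> *\<^sub>C 1)) + k"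
proof -
  let ?K = char_ideal
  \<comment> \<open>The module is the enveloping algebra under left multiplication.\<close>
  define Z where "Z = range (\<lambda>c. c *\<^sub>C (1 :: vir uea))"
  have Z: "complex_vec.subspace Z"
    unfolding Z_def complex_vec.subspace_def
    by (auto simp: scaleC_scaleC scaleC_add_left[symmetric] intro: image_eqI[of _ _ 0])
  have Z1: "uea_of x * y \<in> complex_vec.span (Z \<union> ?K)"
    if "uea_of x - b *\<^sub>C 1 \<in> ?K" "y \<in> Z" for x y b
  proof -
    from that(2) obtain c where y: "y = c *\<^sub>C 1" by (auto simp: Z_def)
    have "c *\<^sub>C (uea_of x - b *\<^sub>C 1) + (c * b) *\<^sub>C 1 \<in> complex_vec.span (Z \<union> ?K)"
      using that(1) by (intro complex_vec.span_add complex_vec.span_scale[of "uea_of x - _"]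
          complex_vec.span_base) (auto simp: Z_def)
    then show ?thesis
      by (simp add: y mult_scaleC_right complex_vec.scale_right_diff_distrib scaleC_scaleC)
  qed
  define S where "S = complex_vec.span ({U.monomial js x | js x. x \<in> Z} \<union> ?K)"
  have sub: "lie_submodule (\<lambda>x u. uea_of x * u) S"
    unfolding S_def
    by (rule U.span_monomial_submodule[OF char_ideal_submodule])
      (blast intro: Z1 char_ideal_vd char_ideal_vz)+
  have "u \<in> S"
  proof (induction u rule: uea_induct)
    case (scalar c)
    have "U.monomial [] (c *\<^sub>C 1) \<in> S"
      unfolding S_def Z_def by (intro complex_vec.span_base UnI1) blast
    then show ?case by simp
  next
    case (mult x u)
    then show ?case using sub by (simp add: lie_submodule_def)
  next
    case (add u v)
    then show ?case using sub by (simp add: lie_submodule_def complex_vec.subspace_add)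
  qed
  then obtain a k where ak: "u = a + k" "a \<in> complex_vec.span {U.monomial js x | js x. x \<in> Z}"
    "k \<in> complex_vec.span ?K"
    unfolding S_def complex_vec.span_Un by blast
  have k: "k \<in> ?K"
    using ak(3) char_ideal_submodule complex_vec.span_minimal[of ?K ?K] by (auto simp: lie_submodule_def)
  obtain M X where M: "finite M" "\<And>\<mu>. X \<mu> \<in> Z" "a = (\<Sum>\<mu>\<in>M. U.pbw \<mu> (X \<mu>))"
    using U.span_pbw_expansion[OF Z ak(2)] by blast
  from M(2) have "\<forall>\<mu>. \<exists>c. X \<mu> = c *\<^sub>C 1" by (auto simp: Z_def)
  then obtain c where "\<And>\<mu>. X \<mu> = c \<mu> *\<^sub>C 1" by metis
  then show thesis using that[OF M(1) k, of c] ak(1) M(3) by simp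
qed

end

section \<open>The isomorphism\<close>

context vir_module_char_nonzero
begin

context
  fixes w :: 'v and \<xi> :: complex
  assumes w: "w \<in> whittaker_vectors" "w \<noteq> 0"
    and center: "z v = \<xi> *\<^sub>C v"
    and simple: "lie_submodule act S \<Longrightarrow> S = {0} \<or> S = UNIV"
begin

interpretation U: vir_module "\<lambda>x u. uea_of x * u"
  by unfold_locales (rule lie_module_uea)

lemmas uact = uea_act_simps[OF module] linC_uea_act[OF module] linC_uea_act_left[OF module]

lemma uea_act_incl: "uea_act act (uea_incl r) w = uea_lift (nz_char \<psi> \<xi>) r *\<^sub>C w"
proof (induction r rule: uea_induct)
  case (scalar c)
  then show ?case
    by (simp add: uea_incl_def uea_lift_simps[OF lie_hom_nz_incl] uact
        uea_lift_simps[OF lie_hom_nz_char[OF char, of \<xi>]] scaleC_complex_def)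
next
  case (mult y r)
  obtain x c where x: "nz_incl y = x + c *\<^sub>C vz" "x \<in> nplus"
    using nz_incl[of y] by (auto simp: nplus_z_def)
  have "act (nz_incl y) w = nz_char \<psi> \<xi> y *\<^sub>C w"
    using w(1) x(2) unfolding x(1) nz_char_eq[OF x(2,1)] whittaker_vectors_def
    by (simp add: act_left_simps center scaleC_add_left scaleC_scaleC)
  with mult show ?case
    by (simp add: uea_incl_def uea_lift_simps[OF lie_hom_nz_incl] uact act_simps
        uea_lift_simps[OF lie_hom_nz_char[OF char, of \<xi>]] scaleC_scaleC mult.commute)
next
  case (add r r')
  then show ?case
    by (simp add: uea_incl_def uea_lift_simps[OF lie_hom_nz_incl] uact
        uea_lift_simps[OF lie_hom_nz_char[OF char, of \<xi>]] scaleC_add_left)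
qed

text \<open>The map \<open>u \<otimes> c \<mapsto> c u w\<close> on representatives.\<close>

definition induced_eval :: "(vir uea \<times> complex \<Rightarrow>\<^sub>0 int) \<Rightarrow> 'v" where
  "induced_eval = frag_eval (\<lambda>(u, c). c *\<^sub>C uea_act act u w)"

lemma induced_eval_kernel: "a \<in> induced_kernel \<psi> \<xi> \<Longrightarrow> induced_eval a = 0"
  unfolding induced_kernel_def tensor_kernel_def
proof (induction a rule: group_closure.induct)
  case (base a)
  then show ?case
    unfolding induced_eval_def
    by (auto simp: frag_eval_diff uact scaleC_add_left scaleC_add_right uea_act_incl
        linC_scaleC[OF linC_uea_act[OF module]] scaleC_scaleC mult.commute)
qed (simp add: induced_eval_def frag_eval_diff)

lemma uea_act_monomial: "uea_act act (U.monomial js u) w = monomial js (uea_act act u w)"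
  by (induction js) (simp_all add: uact)

text \<open>Both \<open>V\<close> and \<open>L(\<psi>, \<xi>)\<close> are quotients of \<open>U(g)\<close> by the annihilators of their generators, so this
  equality contains the isomorphism. If \<open>u w = 0\<close>, expand \<open>u\<close> in ordered monomials modulo the ideal; by
  independence in \<open>V\<close> all coefficients vanish.\<close>

lemma uea_annihilator:
  "uea_act act u w = 0 \<longleftrightarrow> u \<in> char_ideal \<psi> \<xi>"
proof
  assume "u \<in> char_ideal \<psi> \<xi>"
  then have "frag_of (u, 1) \<in> induced_kernel \<psi> \<xi>" by (simp add: char_ideal_def[OF char])
  from induced_eval_kernel[OF this] show "uea_act act u w = 0"
    by (simp add: induced_eval_def scaleC_one)
next
  assume u0: "uea_act act u w = 0"
  obtain M c k where M: "finite M" "k \<in> char_ideal \<psi> \<xi>"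
    "u = (\<Sum>\<mu>\<in>M. U.pbw \<mu> (c \<mu> *\<^sub>C 1)) + k"
    by (rule uea_pbw_expansion[OF char])
  have "frag_of (k, 1) \<in> induced_kernel \<psi> \<xi>" using M(2) by (simp add: char_ideal_def[OF char])
  from induced_eval_kernel[OF this] have "uea_act act k w = 0"
    by (simp add: induced_eval_def scaleC_one)
  then have "(\<Sum>\<mu>\<in>M. uea_act act (U.pbw \<mu> (c \<mu> *\<^sub>C 1)) w) = 0"
    using u0 unfolding M(3) uact(4) linC_sum[OF linC_uea_act_left[OF module]] by simp
  then have "(\<Sum>\<mu>\<in>M. pbw \<mu> (c \<mu> *\<^sub>C w)) = 0"
    by (simp only: uea_act_monomial uact(2,3))
  from pbw_independent[OF M(1) complex_vec.subspace_scale[OF subspace_whittaker w(1)] this]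
  have "c \<mu> *\<^sub>C w = 0" if "\<mu> \<in> M" for \<mu> using that by blast
  then have "c \<mu> = 0" if "\<mu> \<in> M" for \<mu> using that w(2) complex_vec.scale_eq_0_iff by blast
  then have "(\<Sum>\<mu>\<in>M. U.pbw \<mu> (c \<mu> *\<^sub>C 1)) = 0"
    by (intro sum.neutral) (simp add: linC_zero[OF U.linC_monomial])
  then show "u \<in> char_ideal \<psi> \<xi>" using M(2,3) by simp
qed

lemma uea_act_surj: "\<exists>u. uea_act act u w = v"
proof -
  let ?S = "range (\<lambda>u. uea_act act u w)"
  have "lie_submodule act ?S"
    unfolding lie_submodule_def complex_vec.subspace_def
  proof (intro conjI allI ballI)
    show "0 \<in> ?S" by (rule image_eqI[of _ _ "0 *\<^sub>C 1"]) (simp_all add: linC_zero[OF linC_uea_act_left[OF module]])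
    show "x + y \<in> ?S" if "x \<in> ?S" "y \<in> ?S" for x y
      using that by (auto simp flip: uact(4))
    show "c *\<^sub>C x \<in> ?S" if "x \<in> ?S" for c x
      using that by (auto simp flip: uact(2))
    show "act x y \<in> ?S" if "y \<in> ?S" for x y
      using that by (auto simp flip: uact(1) uact(5))
  qed
  moreover have "w \<in> ?S" using uact(3)[of w] by (metis rangeI)
  ultimately have "?S = UNIV" using simple[of ?S] w(2) by blast
  then show ?thesis by (metis UNIV_I imageE)
qed

text \<open>The isomorphism sends \<open>u w\<close> to \<open>u \<otimes> 1\<close>. Working in this direction, \<open>uea_annihilator\<close> gives both well-definedness and injectivity.\<close>

lemma module_iso_whittaker_L: "\<exists>f. module_iso act (whittaker_L \<psi> \<xi>) f"
proof -
  let ?R = "whittaker_rel \<psi> \<xi>"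
  note E = equiv_whittaker_rel[of \<psi> \<xi>]
  obtain r where r: "\<And>v. uea_act act (r v) w = v" using uea_act_surj by metis
  have same: "?R `` {frag_of (u, 1)} = ?R `` {frag_of (u', 1)} \<longleftrightarrow> uea_act act u w = uea_act act u' w" for u u'
  proof -
    have "uea_act act u w = uea_act act u' w \<longleftrightarrow> uea_act act (u - u') w = 0"
      by (simp add: linC_diff[OF linC_uea_act_left[OF module]])
    also have "\<dots> \<longleftrightarrow> (frag_of (u, 1), frag_of (u', 1)) \<in> ?R"
      unfolding uea_annihilator char_ideal_diff[OF char] ..
    also have "\<dots> \<longleftrightarrow> ?R `` {frag_of (u, 1)} = ?R `` {frag_of (u', 1)}"
      using eq_equiv_class_iff[OF E] by simp
    finally show ?thesis by simp
  qed
  define f where "f v = ?R `` {frag_of (r v, 1)}" for v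
  have f: "f (uea_act act u w) = ?R `` {frag_of (u, 1)}" for u
    unfolding f_def same r ..
  have "module_iso act (whittaker_L \<psi> \<xi>) f"
    unfolding module_iso_def
  proof (intro conjI allI)
    show "bij_betw f UNIV (mcarrier (whittaker_L \<psi> \<xi>))"
      unfolding whittaker_L_simps
    proof (intro bij_betwI' ballI)
      show "f v = f v' \<longleftrightarrow> v = v'" for v v' by (simp add: f_def same r)
      show "f v \<in> UNIV // ?R" for v unfolding f_def by (rule quotientI) simp
      show "\<exists>v\<in>UNIV. X = f v" if "X \<in> UNIV // ?R" for X
      proof -
        from that obtain a where a: "X = ?R `` {a}" by (auto elim: quotientE)
        obtain u where "(a, frag_of (u, 1)) \<in> ?R" using induced_module_element[OF char] by blast
        then have "X = ?R `` {frag_of (u, 1)}" unfolding a by (rule equiv_class_eq[OF E])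
        then show ?thesis using f[of u] by blast
      qed
    qed
    show "f (v + v') = madd (whittaker_L \<psi> \<xi>) (f v) (f v')" for v v'
    proof -
      have "f (v + v') = ?R `` {frag_of (r v + r v', 1)}" using f[of "r v + r v'"] by (simp add: uact r)
      also have "\<dots> = ?R `` {frag_of (r v, 1) + frag_of (r v', 1)}"
        using induced_kernel_gens(1)[of "r v" "r v'" 1 \<psi> \<xi>]
        by (intro equiv_class_eq[OF E]) (simp add: whittaker_rel_iff algebra_simps)
      finally show ?thesis by (simp add: f_def whittaker_L_simps)
    qed
    show "f (c *\<^sub>C v) = mscale (whittaker_L \<psi> \<xi>) c (f v)" for c v
      using f[of "c *\<^sub>C r v"] by (simp add: uact r f_def[of v] whittaker_L_simps left_mult_of mult_scaleC_left)
    show "f (act x v) = mact (whittaker_L \<psi> \<xi>) x (f v)" for x v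
      using f[of "uea_of x * r v"] by (simp add: uact r f_def[of v] whittaker_L_simps left_mult_of)
  qed
  then show ?thesis by blast
qed

end

end

theorem proposition3p4:
  fixes \<psi> :: "vir \<Rightarrow> complex"
    and act :: "vir \<Rightarrow> 'v::complex_vector \<Rightarrow> 'v"
  assumes "nplus_char \<psi>"
    and "\<exists>x\<in>nplus. \<psi> x \<noteq> 0"
    and "simple_in_W_psi \<psi> act"
  shows "\<exists>\<xi>. \<exists>f. module_iso act (whittaker_L \<psi> \<xi>) f"
proof -
  have module: "lie_module act" and V: "in_W_psi \<psi> act UNIV" and nz: "(UNIV :: 'v set) \<noteq> {0}"
    and irr: "\<And>S. in_W_psi \<psi> act S \<Longrightarrow> S = {0} \<or> S = UNIV"
    using assms(3) unfolding simple_in_W_psi_def by blast+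
  have nil: "\<exists>k. ((\<lambda>w. act x w - \<psi> x *\<^sub>C w) ^^ k) v = 0" if "x \<in> nplus" for x v
  proof -
    have "v \<in> psi_part \<psi> act UNIV" using V by (simp add: in_W_psi_def)
    then have "\<forall>\<^sub>F k in sequentially. ((\<lambda>w. act x w - \<psi> x *\<^sub>C w) ^^ k) v = 0"
      using that unfolding psi_part_def by blast
    then show ?thesis unfolding eventually_sequentially by blast
  qed
  have "in_W_psi \<psi> act S" if "lie_submodule act S" for S
  proof -
    have "fin_dim (nplus_orbit act v)" for v using V by (simp add: in_W_psi_def in_W_def)
    moreover have "S = psi_part \<psi> act S"
      using V unfolding in_W_psi_def psi_part_def by blast
    ultimately show ?thesis using that by (simp add: in_W_psi_def in_W_def)
  qed
  with irr have simple: "\<And>S. lie_submodule act S \<Longrightarrow> S = {0} \<or> S = UNIV" by blast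
  obtain k where k: "k > 0" "\<psi> (vd k) \<noteq> 0"
    using nplus_char_zeroI[OF assms(1)] assms(2) by blast
  have "k < 3" using k(2) nplus_char_vd_zero[OF assms(1), of k] by (cases "k < 3") auto
  with k(1) have "k = 1 \<or> k = 2" by linarith
  with k(2) have psi12: "\<psi> (vd 1) \<noteq> 0 \<or> \<psi> (vd 2) \<noteq> 0" by auto
  define s :: int where "s = (if \<psi> (vd 2) = 0 then 1 else 2)"
  interpret vir_module_char_nonzero act \<psi> s
  proof
    show "\<psi> (vd k) = 0" if "k > s" for k
      using that nplus_char_vd_zero[OF assms(1), of k] by (cases "k = 2") (auto simp: s_def split: if_splits)
    show "s = 1 \<or> s = 2" "\<psi> (vd s) \<noteq> 0" using psi12 by (auto simp: s_def)
  qed (rule module, rule assms(1))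
  obtain v :: 'v where "v \<noteq> 0" using nz by blast
  moreover have "fin_dim (nplus_orbit act v)" using V by (simp add: in_W_psi_def in_W_def)
  moreover have "\<exists>p. (shifted_d k ^^ p) v = 0" if "k > 0" for k v
    using nil[OF vd_in_nplus[OF that], of v] by (simp add: shifted_d_def[abs_def])
  ultimately obtain w where w: "w \<in> whittaker_vectors" "w \<noteq> 0"
    using whittaker_vector_exists by blast
  obtain \<xi> where "\<And>v. z v = \<xi> *\<^sub>C v" using center_acts_by_scalar[OF simple w] by blast
  from module_iso_whittaker_L[OF w this simple] show ?thesis by blast
qed

end
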